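(* Let $s_1,s_2,\dots,s_n$ be $n$ integers such that $s_i\not\equiv s_j \pmod n$ if $i\ne j$ and $\sum_{j=1}^n s_j\neq 0$. Then a generic $n\times n$ matrix is a product of elements in $\mathrm{Vand}_{s_i}$ and $\mathrm{Vand}_{s_i}^{\mathsf T}$, $i=1,2,\dots,n$.
   Context: All matrices are complex $n\times n$. For an integer $s$, a generalized Vandermonde matrix of type $s$ is an $n\times n$ matrix whose $(p,q)$ entry is $x_q^{s+p-1}$, $1\le p,q\le n$, for some $x_1,\dots,x_n\in\mathbb{C}$ (for which these powers are defined). $\mathrm{Vand}_s$ denotes the set of all generalized Vandermonde matrices of type $s$, and $\mathrm{Vand}_s^{\mathsf T}$ the set of transposes of generalized Vandermonde matrices of type $s$. An algebraic subvariety is the zero set of finitely many polynomials. A property holds for a generic $n\times n$ matrix if there is an algebraic subvariety $Z\subsetneq\mathbb{C}^{n\times n}$ such that every matrix in $\mathbb{C}^{n\times n}$ not having the property lies in $Z$. *)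

theory Defs
  imports
    "HOL-Analysis.Analysis"
    "HOL-Library.Poly_Mapping"
    "HOL-Number_Theory.Cong"
begin

(* The rows of a matrix are numbered 1, ..., n = CARD('n) along the linear order of 'n. *)
definition index_pos :: "'n::{finite,linorder} \<Rightarrow> int" where
  "index_pos p = int (card {..p})"

definition gen_vandermonde :: "int \<Rightarrow> complex ^ 'n::{finite,linorder} \<Rightarrow> complex ^ 'n::{finite,linorder} ^ 'n::{finite,linorder}" where
  "gen_vandermonde s x = (\<chi> p q. (x $ q) powi (s + index_pos p - 1))"

(* The side condition says that all the powers occurring in the matrix are defined
   (0 powi k = 0 for k < 0 is only a library convention); x powi 0 = 1 also for x = 0. *)
definition Vand :: "int \<Rightarrow> (complex ^ 'n::{finite,linorder} ^ 'n::{finite,linorder}) set" where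
  "Vand s = {gen_vandermonde s x |x.
     \<forall>p q. x $ q = 0 \<longrightarrow> 0 \<le> s + index_pos (p::'n) - 1}"

definition Vand_transpose :: "int \<Rightarrow> (complex ^ 'n::{finite,linorder} ^ 'n::{finite,linorder}) set" where
  "Vand_transpose s = transpose ` Vand s"

(* Polynomials over the complex numbers in the indeterminates X (p, q), p and q in 'n, are finitely
   supported families of coefficients indexed by the finitely supported exponent functions. *)
type_synonym 'n entry_poly = "(('n \<times> 'n) \<Rightarrow>\<^sub>0 nat) \<Rightarrow>\<^sub>0 complex"

definition eval_entry_poly :: "'n entry_poly \<Rightarrow> complex ^ 'n ^ ('n::finite) \<Rightarrow> complex" where
  "eval_entry_poly P A =
     (\<Sum>m\<in>Poly_Mapping.keys P. Poly_Mapping.lookup P m *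
        (\<Prod>(p, q)\<in>UNIV. (A $ p $ q) ^ Poly_Mapping.lookup m (p, q)))"

definition algebraic_subvariety :: "(complex ^ 'n ^ 'n::finite) set \<Rightarrow> bool" where
  "algebraic_subvariety Z \<longleftrightarrow>
     (\<exists>F :: 'n entry_poly set. finite F \<and> Z = {A. \<forall>P\<in>F. eval_entry_poly P A = 0})"

definition generic_matrix :: "(complex ^ 'n ^ 'n::finite \<Rightarrow> bool) \<Rightarrow> bool" where
  "generic_matrix Q \<longleftrightarrow>
     (\<exists>Z. algebraic_subvariety Z \<and> Z \<subset> UNIV \<and> (\<forall>A. \<not> Q A \<longrightarrow> A \<in> Z))"

(* A is a product with exactly one factor from each member X k of the family X; the factors may
   come in any order, recorded by the enumeration ks of the index type. *)
definition product_of_elements_in ::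
  "('k::finite \<Rightarrow> (complex ^ 'n ^ 'n::finite) set) \<Rightarrow> complex ^ 'n ^ 'n \<Rightarrow> bool" where
  "product_of_elements_in X A \<longleftrightarrow>
     (\<exists>ks M. distinct ks \<and> set ks = UNIV \<and> (\<forall>k. M k \<in> X k) \<and>
        A = foldr (\<lambda>k B. M k ** B) ks (mat 1))"

end

theory Submission
  imports Defs
    "HOL-Computational_Algebra.Fundamental_Theorem_Algebra"
    "HOL-Library.Real_Mod"
begin

text \<open>Write \<open>n\<close> for the dimension.  Multiply the factors in the order
\<open>V\<^sub>0 W\<^sub>0 V\<^sub>1 W\<^sub>1 \<dots>\<close>, where \<open>V\<^sub>j\<close> is a Vandermonde matrix of type
\<open>s (a j)\<close> and \<open>W\<^sub>j\<close> a transposed one of type \<open>s (b j)\<close>, for two enumerations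
\<open>a\<close> and \<open>b\<close> of the indices.  Keep the \<open>W\<^sub>j\<close> fixed, with the complex conjugates of
the \<open>n\<close>-th roots of unity as nodes, and let the nodes of the \<open>V\<^sub>j\<close> vary over all nonzero
complex numbers.  This is a Laurent polynomial map from \<open>n\<^sup>2\<close> unknowns to \<open>n\<^sup>2\<close>
entries, and two facts about it prove the theorem.

First, its image contains a nonempty open set in the usual topology
(\<open>interior_vandermonde_products\<close>), because its derivative is onto when all nodes are roots of
unity.  At that point \<open>V\<^sub>j\<close> is a Fourier matrix with cyclically shifted rows and
\<open>V\<^sub>j W\<^sub>j\<close> is \<open>n\<close> times the cyclic shift by \<open>s (a j) - s (b j)\<close>.  Moving the nodes of
\<open>V\<^sub>j\<close> contributes to the derivative, up to a fixed shift and a scalar, all products of a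
diagonal matrix \<open>D\<^sub>j\<close> with arbitrary circulant matrices.  The diagonal entries of
\<open>D\<^sub>j\<close> are \<open>s (a j) + (p + K\<^sub>j) mod n\<close> for \<open>p = 0, \<dots>, n - 1\<close>, where
\<open>K\<^sub>j\<close> is the sum of the shifts of the preceding pairs.  So the derivative is onto as soon as the
\<open>n\<close> diagonals \<open>D\<^sub>j\<close> are linearly independent.  Since the \<open>s i\<close> form a complete
residue system modulo \<open>n\<close>, the enumerations can be chosen such that the \<open>K\<^sub>j\<close> are
\<open>0, 1, \<dots>, n - 3, n - 2, n - 2\<close> modulo \<open>n\<close> (\<open>exists_pairing\<close>).  The repeated shift
puts the identity matrix into the span of the diagonals, and differences of consecutive sawtooth
functions do the rest (\<open>sawtooth_span\<close>).  For \<open>n = 1\<close> the only diagonal consists of the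
single number \<open>s i\<close>, which is nonzero because it is the sum of all the \<open>s i\<close>.

Second, a set of matrices that is described by polynomial equations and inequations with additional
existentially quantified unknowns, and that contains a nonempty open set, contains all matrices
outside a proper subvariety (\<open>generic_matrix_projection\<close>).  This is Chevalley's theorem on
constructible sets, here proved by quantifier elimination for the complex numbers
(\<open>constructible_projection\<close>), combined with the observation that a constructible condition is
constant outside a hypersurface (\<open>constructible_generically_constant\<close>).\<close>

section \<open>Constructible conditions and elimination of quantifiers\<close>

inductive polyfun :: "(('v \<Rightarrow> complex) \<Rightarrow> complex) \<Rightarrow> bool" where
  const: "polyfun (\<lambda>e. c)"
| var: "polyfun (\<lambda>e. e v)"
| add: "polyfun f \<Longrightarrow> polyfun g \<Longrightarrow> polyfun (\<lambda>e. f e + g e)"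
| mult: "polyfun f \<Longrightarrow> polyfun g \<Longrightarrow> polyfun (\<lambda>e. f e * g e)"

lemma polyfun_diff: "polyfun f \<Longrightarrow> polyfun g \<Longrightarrow> polyfun (\<lambda>e. f e - g e)"
  using polyfun.add[of f "\<lambda>e. (-1) * g e"] polyfun.mult[OF polyfun.const[of "-1"], of g] by simp

lemma polyfun_sum: "(\<And>i. i \<in> I \<Longrightarrow> polyfun (f i)) \<Longrightarrow> polyfun (\<lambda>e. \<Sum>i\<in>I. f i e)"
  by (induction I rule: infinite_finite_induct) (auto intro: polyfun.intros)

lemma polyfun_power: "polyfun f \<Longrightarrow> polyfun (\<lambda>e. f e ^ k)"
  by (induction k) (auto intro: polyfun.intros)

inductive constructible :: "(('v \<Rightarrow> complex) \<Rightarrow> bool) \<Rightarrow> bool" where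
  zero: "polyfun f \<Longrightarrow> constructible (\<lambda>e. f e = 0)"
| nonzero: "polyfun f \<Longrightarrow> constructible (\<lambda>e. f e \<noteq> 0)"
| conj: "constructible C \<Longrightarrow> constructible D \<Longrightarrow> constructible (\<lambda>e. C e \<and> D e)"
| disj: "constructible C \<Longrightarrow> constructible D \<Longrightarrow> constructible (\<lambda>e. C e \<or> D e)"

lemma constructible_True: "constructible (\<lambda>e. True)"
  using constructible.zero[OF polyfun.const[of 0]] by simp

lemma constructible_False: "constructible (\<lambda>e. False)"
  using constructible.zero[OF polyfun.const[of 1]] by simp

lemma constructible_Ball:
  "finite I \<Longrightarrow> (\<And>i. i \<in> I \<Longrightarrow> constructible (C i)) \<Longrightarrow> constructible (\<lambda>e. \<forall>i\<in>I. C i e)"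
  by (induction I rule: finite_induct) (auto intro: constructible_True constructible.conj)

lemma constructible_Bex:
  "finite I \<Longrightarrow> (\<And>i. i \<in> I \<Longrightarrow> constructible (C i)) \<Longrightarrow> constructible (\<lambda>e. \<exists>i\<in>I. C i e)"
  by (induction I rule: finite_induct) (auto intro: constructible_False constructible.disj)

text \<open>A univariate polynomial whose coefficients are polynomial functions of parameters.  The bound
\<open>n\<close> is strict, so that \<open>n = 0\<close> describes the zero polynomial and the formal leading
coefficient is the one of index \<open>n - 1\<close>; that coefficient may vanish at some parameters.\<close>

definition poly_family :: "nat \<Rightarrow> (('v \<Rightarrow> complex) \<Rightarrow> complex poly) \<Rightarrow> bool" where
  "poly_family n P \<longleftrightarrow>
     (\<forall>e. \<forall>i\<ge>n. coeff (P e) i = 0) \<and> (\<forall>i. polyfun (\<lambda>e. coeff (P e) i))"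

lemma poly_family_const: assumes "polyfun f" shows "poly_family (Suc 0) (\<lambda>e. [:f e:])"
proof -
  have "polyfun (\<lambda>e. coeff [:f e:] i)" for i
    using assms by (cases i) (auto intro: polyfun.const)
  then show ?thesis by (auto simp: poly_family_def coeff_pCons split: nat.splits)
qed

lemma poly_family_indeterminate: "poly_family 2 (\<lambda>e. [:0, 1:])"
  by (auto simp: poly_family_def coeff_pCons split: nat.splits intro: polyfun.intros)

lemma poly_family_add:
  "poly_family m P \<Longrightarrow> poly_family n Q \<Longrightarrow> poly_family (max m n) (\<lambda>e. P e + Q e)"
  by (auto simp: poly_family_def intro: polyfun.intros)

lemma poly_family_mult:
  assumes "poly_family m P" "poly_family n Q"
  shows "poly_family (m + n) (\<lambda>e. P e * Q e)"
proof -
  have "coeff (P e * Q e) i = 0" if "i \<ge> m + n" for e i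
  proof -
    have "coeff (P e) j * coeff (Q e) (i - j) = 0" for j
      using assms that by (cases "j \<ge> m") (auto simp: poly_family_def)
    then show ?thesis unfolding coeff_mult by (intro sum.neutral) blast
  qed
  moreover have "polyfun (\<lambda>e. coeff (P e * Q e) i)" for i
    using assms unfolding coeff_mult poly_family_def
    by (intro polyfun_sum polyfun.mult) auto
  ultimately show ?thesis by (auto simp: poly_family_def)
qed

lemma poly_family_power: "poly_family m P \<Longrightarrow> \<exists>n. poly_family n (\<lambda>e. P e ^ k)"
proof (induction k)
  case 0
  then show ?case using poly_family_const[OF polyfun.const[of 1]] by (auto simp: one_pCons)
next
  case (Suc k)
  then show ?case using poly_family_mult by fastforce
qed

text \<open>Makes the variable \<open>v\<close> explicit, so that eliminating it becomes a question about common
roots of univariate polynomials with parameters.\<close>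

lemma polyfun_as_poly_family:
  "polyfun f \<Longrightarrow> \<exists>n P. poly_family n P \<and> (\<forall>e x. f (e(v := x)) = poly (P e) x)"
proof (induction rule: polyfun.induct)
  case (const c)
  then show ?case by (intro exI[of _ "Suc 0"] exI[of _ "\<lambda>e. [:c:]"]) (auto intro: poly_family_const polyfun.intros)
next
  case (var w)
  show ?case
  proof (cases "w = v")
    case True
    then show ?thesis using poly_family_indeterminate by (intro exI[of _ 2] exI[of _ "\<lambda>e. [:0, 1:]"]) auto
  next
    case False
    then show ?thesis
      by (intro exI[of _ "Suc 0"] exI[of _ "\<lambda>e. [:e w:]"]) (auto intro!: poly_family_const polyfun.intros)
  qed
next
  case (add f g)
  then obtain m P n Q where "poly_family m P" "\<forall>e x. f (e(v := x)) = poly (P e) x"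
    "poly_family n Q" "\<forall>e x. g (e(v := x)) = poly (Q e) x" by blast
  then show ?case using poly_family_add
    by (intro exI[of _ "max m n"] exI[of _ "\<lambda>e. P e + Q e"]) (auto simp del: fun_upd_apply)
next
  case (mult f g)
  then obtain m P n Q where "poly_family m P" "\<forall>e x. f (e(v := x)) = poly (P e) x"
    "poly_family n Q" "\<forall>e x. g (e(v := x)) = poly (Q e) x" by blast
  then show ?case using poly_family_mult
    by (intro exI[of _ "m + n"] exI[of _ "\<lambda>e. P e * Q e"]) (auto simp del: fun_upd_apply)
qed

text \<open>One step of pseudo-division of \<open>R\<close> (formal degree \<open>n\<close>) by \<open>P\<close> (formal degree
\<open>m\<close>).  Multiplying \<open>R\<close> by the leading coefficient of \<open>P\<close> avoids a division, so
the coefficients stay polynomial in the parameters.\<close>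

definition pseudo_reduce ::
  "nat \<Rightarrow> ('e \<Rightarrow> complex poly) \<Rightarrow> nat \<Rightarrow> ('e \<Rightarrow> complex poly) \<Rightarrow> 'e \<Rightarrow> complex poly" where
  "pseudo_reduce m P n R e =
     smult (coeff (P e) m) (R e) - monom (coeff (R e) n) (n - m) * P e"

lemma poly_family_pseudo_reduce:
  assumes P: "poly_family (Suc m) P" and R: "poly_family (Suc n) R" and le: "m \<le> n"
  shows "poly_family n (pseudo_reduce m P n R)"
proof -
  have co: "coeff (pseudo_reduce m P n R e) i = coeff (P e) m * coeff (R e) i
      - (if i < n - m then 0 else coeff (R e) n * coeff (P e) (i - (n - m)))" for e i
    by (simp add: pseudo_reduce_def coeff_monom_mult)
  have "coeff (pseudo_reduce m P n R e) i = 0" if "i \<ge> n" for e i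
  proof (cases "i = n")
    case True
    then show ?thesis using le by (simp add: co)
  next
    case False
    then have "i \<ge> Suc n" "i - (n - m) \<ge> Suc m" using that le by auto
    then show ?thesis using P R by (simp add: co poly_family_def)
  qed
  moreover have "polyfun (\<lambda>e. coeff (pseudo_reduce m P n R e) i)" for i
    using P R unfolding co poly_family_def
    by (cases "i < n - m") (auto intro!: polyfun_diff polyfun.intros)
  ultimately show ?thesis by (auto simp: poly_family_def)
qed

lemma poly_pseudo_reduce_eq_0_iff:
  assumes "coeff (P e) m \<noteq> 0" "poly (P e) x = 0"
  shows "poly (pseudo_reduce m P n R e) x = 0 \<longleftrightarrow> poly (R e) x = 0"
  using assms by (simp add: pseudo_reduce_def)

lemma dvd_pseudo_reduce_iff:
  assumes "coeff (P e) m \<noteq> 0"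
  shows "P e dvd pseudo_reduce m P n R e \<longleftrightarrow> P e dvd R e"
proof -
  have "P e dvd pseudo_reduce m P n R e \<longleftrightarrow> P e dvd smult (coeff (P e) m) (R e)"
    unfolding pseudo_reduce_def using dvd_diff_left_iff dvd_triv_right by blast
  also have "\<dots> \<longleftrightarrow> P e dvd R e"
    using assms by (simp add: dvd_smult_iff)
  finally show ?thesis .
qed

lemma constructible_poly_family_nonzero:
  assumes "poly_family n R"
  shows "constructible (\<lambda>e. R e \<noteq> 0)"
proof -
  have "R e \<noteq> 0 \<longleftrightarrow> (\<exists>i\<in>{..<n}. coeff (R e) i \<noteq> 0)" for e
    using assms unfolding poly_family_def poly_eq_iff by (metis coeff_0 lessThan_iff not_le)
  then show ?thesis
    using assms by (auto simp: poly_family_def intro!: constructible_Bex constructible.nonzero)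
qed

text \<open>Pseudo-division replaces \<open>R\<close> by a family of formal degree below that of \<open>P\<close>, and then
divisibility can only mean that \<open>R\<close> is zero.\<close>

lemma constructible_not_dvd:
  assumes P: "poly_family (Suc m) P" and R: "poly_family n R"
  shows "constructible (\<lambda>e. coeff (P e) m \<noteq> 0 \<and> \<not> P e dvd R e)"
  using R
proof (induction n arbitrary: R rule: less_induct)
  case (less n)
  show ?case
  proof (cases "n \<le> m")
    case True
    have "P e dvd R e \<longleftrightarrow> R e = 0" if a: "coeff (P e) m \<noteq> 0" for e
    proof
      assume d: "P e dvd R e"
      show "R e = 0"
      proof (rule ccontr)
        assume nz: "R e \<noteq> 0"
        then have "degree (R e) < n"
          using less.prems unfolding poly_family_def by (meson leading_coeff_neq_0 not_le)
        moreover have "m \<le> degree (P e)" using a by (rule le_degree)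
        ultimately show False using dvd_imp_degree_le[OF d nz] True by simp
      qed
    qed simp
    then have "(\<lambda>e. coeff (P e) m \<noteq> 0 \<and> \<not> P e dvd R e)
        = (\<lambda>e. coeff (P e) m \<noteq> 0 \<and> R e \<noteq> 0)" by auto
    moreover have "constructible (\<lambda>e. coeff (P e) m \<noteq> 0)"
      using P by (auto simp: poly_family_def intro: constructible.nonzero)
    ultimately show ?thesis
      by (simp only: constructible.conj constructible_poly_family_nonzero[OF less.prems])
  next
    case False
    then obtain k where k: "n = Suc k" "m \<le> k" by (cases n) auto
    have "(\<lambda>e. coeff (P e) m \<noteq> 0 \<and> \<not> P e dvd R e)
        = (\<lambda>e. coeff (P e) m \<noteq> 0 \<and> \<not> P e dvd pseudo_reduce m P k R e)"
      using dvd_pseudo_reduce_iff[of P _ m k R] by (intro ext) auto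
    then show ?thesis
      using less.IH[of k] poly_family_pseudo_reduce[OF P] less.prems k by simp
  qed
qed

lemma poly_family_drop_leading:
  assumes "poly_family (Suc m) P"
  shows "poly_family m (\<lambda>e. P e - monom (coeff (P e) m) m)"
proof -
  have "coeff (P e - monom (coeff (P e) m) m) i = (if i = m then 0 else coeff (P e) i)" for e i
    by simp
  moreover have "polyfun (\<lambda>e. if i = m then 0 else coeff (P e) i)" for i
    using assms by (cases "i = m") (auto simp: poly_family_def intro: polyfun.const)
  ultimately show ?thesis
    using assms by (auto simp only: poly_family_def split: if_splits)
qed

text \<open>Elimination of one variable.  The induction is on the total formal size of the equations.  With two
equations of positive size, branch on the leading coefficient of the one of smaller degree: where it
vanishes, that equation loses its leading term; where it does not, it reduces the other equation
without changing the common roots.  With a single equation \<open>P = 0\<close> of exact degree \<open>m\<close>,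
all its roots are roots of \<open>Q\<close> precisely if \<open>P\<close> divides \<open>Q ^ m\<close>; this is where
the algebraic closedness of the complex numbers enters.\<close>

lemma constructible_common_root:
  assumes "\<forall>(n, P)\<in>set L. poly_family n P" "poly_family k Q"
  shows "constructible (\<lambda>e. \<exists>x. (\<forall>(n, P)\<in>set L. poly (P e) x = 0) \<and> poly (Q e) x \<noteq> 0)"
  using assms(1)
proof (induction L rule: measure_induct_rule[where f = "\<lambda>L. \<Sum>(n, P)\<leftarrow>L. Suc n"])
  case (less L)
  let ?S = "\<lambda>L e. \<exists>x. (\<forall>(n, P)\<in>set L. poly (P e) x = 0) \<and> poly (Q e) x \<noteq> 0"
  \<comment> \<open>Case distinction on whether the leading coefficient \<open>a\<close> vanishes.\<close>
  have split: "constructible (?S L)"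
    if "polyfun a" "constructible C" "constructible D"
      "\<And>e. a e = 0 \<Longrightarrow> ?S L e = C e" "\<And>e. ?S L e \<and> a e \<noteq> 0 \<longleftrightarrow> D e" for a C D
  proof -
    have "?S L = (\<lambda>e. (a e = 0 \<and> C e) \<or> D e)"
      using that(4,5) by (intro ext) metis
    then show ?thesis
      using that(1-3) by (simp only: constructible.disj constructible.conj constructible.zero)
  qed
  have zero_bound: "constructible (?S L)" if L: "set L = insert (0, P) (set L')"
    "(\<Sum>(n, P)\<leftarrow>L. Suc n) > (\<Sum>(n, P)\<leftarrow>L'. Suc n)" for P L'
  proof -
    have "P e = 0" for e
      using less.prems L by (auto simp: poly_family_def poly_eq_iff)
    then have "?S L = ?S L'" using L by auto
    then show ?thesis using less.IH[of L'] less.prems L by auto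
  qed
  \<comment> \<open>The branch in which the leading coefficient vanishes.\<close>
  have drop: "constructible (?S ((m, \<lambda>e. P e - monom (coeff (P e) m) m) # L'))"
      "\<And>e. coeff (P e) m = 0 \<Longrightarrow> ?S L e = ?S ((m, \<lambda>e. P e - monom (coeff (P e) m) m) # L') e"
    if L: "set L = insert (Suc m, P) (set L')"
      "(\<Sum>(n, P)\<leftarrow>L. Suc n) = Suc (Suc m) + (\<Sum>(n, P)\<leftarrow>L'. Suc n)" for m P L'
  proof -
    show "constructible (?S ((m, \<lambda>e. P e - monom (coeff (P e) m) m) # L'))"
      using less.prems L by (intro less.IH) (auto intro: poly_family_drop_leading)
    show "?S L e = ?S ((m, \<lambda>e. P e - monom (coeff (P e) m) m) # L') e" if "coeff (P e) m = 0" for e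
      using that L by simp
  qed
  have two: "constructible (?S L)"
    if L: "set L = insert (Suc m, P) (insert (Suc n, R) (set L'))"
      "(\<Sum>(n, P)\<leftarrow>L. Suc n) = Suc (Suc m) + (Suc (Suc n) + (\<Sum>(n, P)\<leftarrow>L'. Suc n))"
      and le: "m \<le> n" for m P n R L'
  proof -
    let ?L1 = "(Suc m, P) # (n, pseudo_reduce m P n R) # L'"
    have fam: "poly_family (Suc m) P" "poly_family (Suc n) R" using less.prems L by auto
    have "constructible (?S ?L1)"
      using less.prems L poly_family_pseudo_reduce[OF fam le]
      by (intro less.IH) auto
    moreover have "polyfun (\<lambda>e. coeff (P e) m)" using fam by (auto simp: poly_family_def)
    moreover have "?S L e = ?S ?L1 e" if "coeff (P e) m \<noteq> 0" for e
      using poly_pseudo_reduce_eq_0_iff[of P e m _ n R] that by (auto simp: L)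
    ultimately show ?thesis
      using drop[of m P "(Suc n, R) # L'"] L
      by (intro split[of "\<lambda>e. coeff (P e) m"
            "?S ((m, \<lambda>e. P e - monom (coeff (P e) m) m) # (Suc n, R) # L')"
            "\<lambda>e. ?S ?L1 e \<and> coeff (P e) m \<noteq> 0"])
        (auto intro!: constructible.conj constructible.nonzero)
  qed
  \<comment> \<open>The rule only serves to distinguish lists with no, one, and at least two equations.\<close>
  show ?case
  proof (cases L rule: remdups_adj.cases)
    case 1
    have "?S L = (\<lambda>e. Q e \<noteq> 0)"
      using 1 poly_all_0_iff_0 by (intro ext) auto
    then show ?thesis using constructible_poly_family_nonzero[OF assms(2)] by simp
  next
    case (2 nP)
    obtain n P where nP: "nP = (n, P)" by force
    show ?thesis
    proof (cases n)
      case 0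
      then show ?thesis using zero_bound[of P "[]"] 2 nP by simp
    next
      case (Suc m)
      have fam: "poly_family (Suc m) P" using less.prems 2 nP Suc by auto
      obtain j where j: "poly_family j (\<lambda>e. Q e ^ m)" using poly_family_power[OF assms(2)] by blast
      have "?S L e \<longleftrightarrow> \<not> P e dvd Q e ^ m" if a: "coeff (P e) m \<noteq> 0" for e
      proof -
        have "degree (P e) = m"
          using fam le_degree[OF a] unfolding poly_family_def
          by (intro antisym degree_le) auto
        then show ?thesis
          using a nullstellensatz_univariate[of "P e" "Q e"] by (auto simp: 2 nP)
      qed
      moreover have "polyfun (\<lambda>e. coeff (P e) m)" using fam by (auto simp: poly_family_def)
      moreover have "set L = insert (Suc m, P) (set [])"
        "(\<Sum>(n, P)\<leftarrow>L. Suc n) = Suc (Suc m) + (\<Sum>(n, P)\<leftarrow>[]. Suc n)"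
        using 2 nP Suc by auto
      note drop = drop[OF this]
      ultimately show ?thesis
        by (intro split[OF _ drop(1) constructible_not_dvd[OF fam j] drop(2)]) auto
    qed
  next
    case (3 nP nR L')
    obtain n P m R where nP: "nP = (n, P)" "nR = (m, R)" by force
    show ?thesis
    proof (cases n)
      case 0
      then show ?thesis using zero_bound[of P "(m, R) # L'"] 3 nP by simp
    next
      case n: (Suc n')
      show ?thesis
      proof (cases m)
        case 0
        show ?thesis
          by (rule zero_bound[of R "(n, P) # L'"]) (simp_all add: 3 nP \<open>m = 0\<close> insert_commute)
      next
        case m: (Suc m')
        show ?thesis
        proof (cases "n' \<le> m'")
          case True
          show ?thesis by (rule two[of n' P m' R L']) (use True in \<open>simp_all add: 3 nP n m\<close>)
        next
          case False
          show ?thesis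
            by (rule two[of m' R n' P L']) (use False in \<open>simp_all add: 3 nP n m insert_commute\<close>)
        qed
      qed
    qed
  qed
qed

text \<open>A single inequation per disjunct suffices because a product is nonzero just if all factors are.\<close>

lemma constructible_dnf:
  "constructible C \<Longrightarrow> \<exists>S. finite S \<and>
     (\<forall>(F, g)\<in>S. finite F \<and> (\<forall>f\<in>F. polyfun f) \<and> polyfun g) \<and>
     (\<forall>e. C e \<longleftrightarrow> (\<exists>(F, g)\<in>S. (\<forall>f\<in>F. f e = 0) \<and> g e \<noteq> 0))"
proof (induction rule: constructible.induct)
  case (zero f)
  then show ?case
    by (intro exI[of _ "{({f}, \<lambda>e. 1)}"]) (auto intro: polyfun.intros)
next
  case (nonzero f)
  then show ?case
    by (intro exI[of _ "{({}, f)}"]) auto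
next
  case (conj C D)
  obtain S where S: "finite S" "\<forall>(F, g)\<in>S. finite F \<and> (\<forall>f\<in>F. polyfun f) \<and> polyfun g"
    "\<forall>e. C e \<longleftrightarrow> (\<exists>(F, g)\<in>S. (\<forall>f\<in>F. f e = 0) \<and> g e \<noteq> 0)" using conj.IH(1) by blast
  obtain T where T: "finite T" "\<forall>(F, g)\<in>T. finite F \<and> (\<forall>f\<in>F. polyfun f) \<and> polyfun g"
    "\<forall>e. D e \<longleftrightarrow> (\<exists>(F, g)\<in>T. (\<forall>f\<in>F. f e = 0) \<and> g e \<noteq> 0)" using conj.IH(2) by blast
  let ?U = "\<Union>Fg\<in>S. (\<lambda>Gh. (fst Fg \<union> fst Gh, \<lambda>e. snd Fg e * snd Gh e)) ` T"
  have "finite ?U" using S(1) T(1) by simp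
  moreover have "\<forall>(F, g)\<in>?U. finite F \<and> (\<forall>f\<in>F. polyfun f) \<and> polyfun g"
    using S(2) T(2) by (simp add: case_prod_beta ball_Un polyfun.mult)
  moreover have "C e \<and> D e \<longleftrightarrow> (\<exists>(F, g)\<in>?U. (\<forall>f\<in>F. f e = 0) \<and> g e \<noteq> 0)" for e
    unfolding S(3)[rule_format] T(3)[rule_format] by (simp add: case_prod_beta ball_Un) blast
  ultimately show ?case by blast
next
  case (disj C D)
  obtain S where S: "finite S" "\<forall>(F, g)\<in>S. finite F \<and> (\<forall>f\<in>F. polyfun f) \<and> polyfun g"
    "\<forall>e. C e \<longleftrightarrow> (\<exists>(F, g)\<in>S. (\<forall>f\<in>F. f e = 0) \<and> g e \<noteq> 0)" using disj.IH(1) by blast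
  obtain T where T: "finite T" "\<forall>(F, g)\<in>T. finite F \<and> (\<forall>f\<in>F. polyfun f) \<and> polyfun g"
    "\<forall>e. D e \<longleftrightarrow> (\<exists>(F, g)\<in>T. (\<forall>f\<in>F. f e = 0) \<and> g e \<noteq> 0)" using disj.IH(2) by blast
  show ?case
    using S T by (intro exI[of _ "S \<union> T"]) (auto simp: ball_Un bex_Un)
qed

text \<open>The existential quantifier commutes with the disjunctions of a disjunctive normal form, so that only
systems of equations with one inequation remain.\<close>

lemma constructible_ex:
  assumes "constructible C"
  shows "constructible (\<lambda>e. \<exists>x. C (e(v := x)))"
proof -
  obtain S where S: "finite S" "\<forall>(F, g)\<in>S. finite F \<and> (\<forall>f\<in>F. polyfun f) \<and> polyfun g"
    "\<forall>e. C e \<longleftrightarrow> (\<exists>(F, g)\<in>S. (\<forall>f\<in>F. f e = 0) \<and> g e \<noteq> 0)"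
    using constructible_dnf[OF assms] by blast
  have "constructible (\<lambda>e. \<exists>x. (\<forall>f\<in>F. f (e(v := x)) = 0) \<and> g (e(v := x)) \<noteq> 0)"
    if Fg: "(F, g) \<in> S" for F g
  proof -
    have F: "finite F" "\<forall>f\<in>F. polyfun f" "polyfun g" using S(2) Fg by auto
    obtain n P where P: "\<And>f. f \<in> F \<Longrightarrow> poly_family (n f) (P f)"
      "\<And>f e x. f \<in> F \<Longrightarrow> f (e(v := x)) = poly (P f e) x"
      using F(2) polyfun_as_poly_family[where v = v] by metis
    obtain k Q where Q: "poly_family k Q" "\<And>e x. g (e(v := x)) = poly (Q e) x"
      using polyfun_as_poly_family[OF F(3), of v] by blast
    obtain fs where fs: "set fs = F" using finite_list[OF F(1)] by blast
    show ?thesis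
      using constructible_common_root[of "map (\<lambda>f. (n f, P f)) fs" k Q] P(1) Q(1)
      by (simp add: fs P(2) Q(2) cong: ball_cong)
  qed
  then have "constructible (\<lambda>e. \<exists>Fg\<in>S. \<exists>x. (\<forall>f\<in>fst Fg. f (e(v := x)) = 0) \<and> snd Fg (e(v := x)) \<noteq> 0)"
    using S(1) by (intro constructible_Bex) auto
  moreover have "(\<lambda>e. \<exists>Fg\<in>S. \<exists>x. (\<forall>f\<in>fst Fg. f (e(v := x)) = 0) \<and> snd Fg (e(v := x)) \<noteq> 0)
      = (\<lambda>e. \<exists>x. C (e(v := x)))"
    unfolding S(3)[rule_format] case_prod_beta by blast
  ultimately show ?thesis by simp
qed

text \<open>Chevalley's theorem for affine space: projecting away finitely many coordinates preserves
constructibility.\<close>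

lemma constructible_projection:
  assumes "finite V" "constructible C"
  shows "constructible (\<lambda>e. \<exists>e'. (\<forall>v. v \<notin> V \<longrightarrow> e' v = e v) \<and> C e')"
  using assms(1)
proof (induction V rule: finite_induct)
  case empty
  have "(\<exists>e'. (\<forall>v. v \<notin> {} \<longrightarrow> e' v = e v) \<and> C e') = C e" for e
  proof -
    have "(\<forall>v. v \<notin> {} \<longrightarrow> e' v = e v) \<longleftrightarrow> e' = e" for e' by auto
    then show ?thesis by simp
  qed
  then show ?case using assms(2) by simp
next
  case (insert w V)
  let ?D = "\<lambda>e. \<exists>e'. (\<forall>v. v \<notin> V \<longrightarrow> e' v = e v) \<and> C e'"
  have "(\<exists>e'. (\<forall>v. v \<notin> insert w V \<longrightarrow> e' v = e v) \<and> C e') \<longleftrightarrow> (\<exists>x. ?D (e(w := x)))" for e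
  proof
    assume "\<exists>e'. (\<forall>v. v \<notin> insert w V \<longrightarrow> e' v = e v) \<and> C e'"
    then obtain e' where "\<forall>v. v \<notin> insert w V \<longrightarrow> e' v = e v" "C e'" by blast
    then show "\<exists>x. ?D (e(w := x))"
      by (intro exI[of _ "e' w"] exI[of _ e']) auto
  next
    assume "\<exists>x. ?D (e(w := x))"
    then show "\<exists>e'. (\<forall>v. v \<notin> insert w V \<longrightarrow> e' v = e v) \<and> C e'"
      by (metis fun_upd_other insertCI)
  qed
  then have eq: "(\<lambda>e. \<exists>e'. (\<forall>v. v \<notin> insert w V \<longrightarrow> e' v = e v) \<and> C e') = (\<lambda>e. \<exists>x. ?D (e(w := x)))"
    by (rule ext)
  show ?case unfolding eq by (rule constructible_ex[OF insert.IH])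
qed

section \<open>Constructible conditions that hold on an open set\<close>

lemma polyfun_subst:
  assumes "polyfun f" "\<And>v. polyfun (\<lambda>e. h e v)"
  shows "polyfun (\<lambda>e. f (h e))"
  using assms(1) by induction (auto intro: polyfun.intros assms(2))

lemma constructible_subst:
  assumes "constructible C" "\<And>v. polyfun (\<lambda>e. h e v)"
  shows "constructible (\<lambda>e. C (h e))"
  using assms(1)
proof induction
  case (zero f)
  show ?case by (rule constructible.zero[OF polyfun_subst[where h = h, OF zero assms(2)]])
next
  case (nonzero f)
  show ?case by (rule constructible.nonzero[OF polyfun_subst[where h = h, OF nonzero assms(2)]])
next
  case (conj C D)
  show ?case by (rule constructible.conj[OF conj.IH])
next
  case (disj C D)
  show ?case by (rule constructible.disj[OF disj.IH])
qed

text \<open>Restricting to a line through two points reduces questions about several variables to polynomials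
in one variable.\<close>

lemma polyfun_on_line:
  "polyfun f \<Longrightarrow> \<exists>p. \<forall>t. f (\<lambda>v. a v + t * (b v - a v)) = poly p t"
proof (induction rule: polyfun.induct)
  case (const c)
  show ?case by (intro exI[of _ "[:c:]"]) simp
next
  case (var v)
  show ?case by (intro exI[of _ "[:a v, b v - a v:]"]) simp
next
  case (add f g)
  then show ?case by (metis poly_add)
next
  case (mult f g)
  then show ?case by (metis poly_mult)
qed

lemma polyfun_mult_not_identically_0:
  assumes "polyfun f" "polyfun g" "f a \<noteq> 0" "g b \<noteq> 0"
  shows "\<exists>e. f e * g e \<noteq> 0"
proof -
  let ?line = "\<lambda>t v. a v + t * (b v - a v)"
  obtain p q where p: "\<And>t. f (?line t) = poly p t" and q: "\<And>t. g (?line t) = poly q t"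
    using polyfun_on_line[OF assms(1), of a b] polyfun_on_line[OF assms(2), of a b] by blast
  have "p \<noteq> 0" "q \<noteq> 0" using p[of 0] q[of 1] assms(3,4) by auto
  then obtain t where "poly (p * q) t \<noteq> 0" using poly_all_0_iff_0[of "p * q"] by auto
  then have "f (?line t) * g (?line t) \<noteq> 0" using p[of t] q[of t] by simp
  then show ?thesis by (intro exI[of _ "?line t"])
qed

text \<open>A constructible condition is decided outside a hypersurface: where all the polynomials occurring in
it that are not identically zero take nonzero values, the truth values of its literals do not change.
The function \<open>g\<close> is the product of those polynomials.\<close>

lemma constructible_generically_constant:
  "constructible C \<Longrightarrow>
     \<exists>g. polyfun g \<and> (\<exists>e. g e \<noteq> 0) \<and> ((\<forall>e. g e \<noteq> 0 \<longrightarrow> C e) \<or> (\<forall>e. g e \<noteq> 0 \<longrightarrow> \<not> C e))"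
proof (induction rule: constructible.induct)
  case (zero f)
  then show ?case
    by (cases "\<forall>e. f e = 0") (auto intro: exI[of _ f] exI[of _ "\<lambda>e. 1"] polyfun.const)
next
  case (nonzero f)
  then show ?case
    by (cases "\<forall>e. f e = 0") (auto intro: exI[of _ f] exI[of _ "\<lambda>e. 1"] polyfun.const)
next
  case (conj C D)
  then obtain g a h b where g: "polyfun g" "g a \<noteq> 0" "(\<forall>e. g e \<noteq> 0 \<longrightarrow> C e) \<or> (\<forall>e. g e \<noteq> 0 \<longrightarrow> \<not> C e)"
    and h: "polyfun h" "h b \<noteq> 0" "(\<forall>e. h e \<noteq> 0 \<longrightarrow> D e) \<or> (\<forall>e. h e \<noteq> 0 \<longrightarrow> \<not> D e)" by blast
  show ?case
  proof (intro exI[of _ "\<lambda>e. g e * h e"] conjI)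
    show "polyfun (\<lambda>e. g e * h e)" by (rule polyfun.mult[OF g(1) h(1)])
    show "\<exists>e. g e * h e \<noteq> 0"
      by (rule polyfun_mult_not_identically_0[of g h, OF g(1) h(1) g(2) h(2)])
    show "(\<forall>e. g e * h e \<noteq> 0 \<longrightarrow> C e \<and> D e) \<or> (\<forall>e. g e * h e \<noteq> 0 \<longrightarrow> \<not> (C e \<and> D e))"
      using g(3) h(3) by (elim disjE) simp_all
  qed
next
  case (disj C D)
  then obtain g a h b where g: "polyfun g" "g a \<noteq> 0" "(\<forall>e. g e \<noteq> 0 \<longrightarrow> C e) \<or> (\<forall>e. g e \<noteq> 0 \<longrightarrow> \<not> C e)"
    and h: "polyfun h" "h b \<noteq> 0" "(\<forall>e. h e \<noteq> 0 \<longrightarrow> D e) \<or> (\<forall>e. h e \<noteq> 0 \<longrightarrow> \<not> D e)" by blast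
  show ?case
  proof (intro exI[of _ "\<lambda>e. g e * h e"] conjI)
    show "polyfun (\<lambda>e. g e * h e)" by (rule polyfun.mult[OF g(1) h(1)])
    show "\<exists>e. g e * h e \<noteq> 0"
      by (rule polyfun_mult_not_identically_0[of g h, OF g(1) h(1) g(2) h(2)])
    show "(\<forall>e. g e * h e \<noteq> 0 \<longrightarrow> C e \<or> D e) \<or> (\<forall>e. g e * h e \<noteq> 0 \<longrightarrow> \<not> (C e \<or> D e))"
      using g(3) h(3) by (elim disjE) simp_all
  qed
qed

abbreviation entries :: "complex ^ 'n ^ 'm \<Rightarrow> 'm \<times> 'n \<Rightarrow> complex" where
  "entries A \<equiv> \<lambda>(p, q). A $ p $ q"

text \<open>On the complex line from a point of \<open>U\<close> to any other point the function is a polynomial in one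
variable with infinitely many zeros.\<close>

lemma polyfun_zero_on_open:
  fixes U :: "(complex ^ 'n ^ 'm) set"
  assumes f: "polyfun f" and U: "open U" "U \<noteq> {}" "\<And>A. A \<in> U \<Longrightarrow> f (entries A) = 0"
  shows "f e = 0"
proof -
  obtain A where A: "A \<in> U" using U by blast
  define B :: "complex \<Rightarrow> complex ^ 'n ^ 'm"
    where "B t = (\<chi> p q. A $ p $ q + t * (e (p, q) - A $ p $ q))" for t
  obtain g where g: "\<And>t. f (\<lambda>v. entries A v + t * (e v - entries A v)) = poly g t"
    using polyfun_on_line[OF f, of "entries A" e] by blast
  have ent: "entries (B t) = (\<lambda>v. entries A v + t * (e v - entries A v))" for t
    by (auto simp: B_def)
  have "continuous_on UNIV B" unfolding B_def by (intro continuous_intros)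
  then have "open (B -` U)" using U(1) by (simp add: open_vimage)
  moreover have "B 0 = A" by (simp add: B_def vec_eq_iff)
  ultimately have "infinite (B -` U)"
    using A finite_imp_not_open[of "B -` U"] by auto
  moreover have "B -` U \<subseteq> {t. poly g t = 0}" using U(3) g ent by fastforce
  ultimately have "g = 0" using poly_roots_finite finite_subset by blast
  then show ?thesis using g[of 1] by simp
qed

lemma eval_entry_poly_superset:
  assumes "finite S" "Poly_Mapping.keys P \<subseteq> S"
  shows "eval_entry_poly P A =
    (\<Sum>m\<in>S. Poly_Mapping.lookup P m * (\<Prod>(p, q)\<in>UNIV. (A $ p $ q) ^ Poly_Mapping.lookup m (p, q)))"
  unfolding eval_entry_poly_def using assms by (intro sum.mono_neutral_left) (auto simp: in_keys_iff)

lemma eval_entry_poly_add: "eval_entry_poly (P + Q) A = eval_entry_poly P A + eval_entry_poly Q A"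
proof -
  let ?S = "Poly_Mapping.keys P \<union> Poly_Mapping.keys Q"
  have "Poly_Mapping.keys (P + Q) \<subseteq> ?S" by (rule Poly_Mapping.keys_add)
  then show ?thesis
    by (simp add: eval_entry_poly_superset[of ?S] lookup_add distrib_right sum.distrib)
qed

lemma eval_entry_poly_sum: "eval_entry_poly (\<Sum>i\<in>I. P i) A = (\<Sum>i\<in>I. eval_entry_poly (P i) A)"
proof -
  have "eval_entry_poly 0 A = 0" by (simp add: eval_entry_poly_def)
  then show ?thesis
    by (induction I rule: infinite_finite_induct) (auto simp: eval_entry_poly_add)
qed

lemma eval_entry_poly_single:
  "eval_entry_poly (Poly_Mapping.single m c) A =
     c * (\<Prod>(p, q)\<in>UNIV. (A $ p $ q) ^ Poly_Mapping.lookup m (p, q))"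
  by (subst eval_entry_poly_superset[of "{m}"]) auto

lemma polyfun_as_entry_poly:
  "polyfun f \<Longrightarrow> \<exists>P. \<forall>A. f (entries A) = eval_entry_poly P A"
proof (induction rule: polyfun.induct)
  case (const c)
  show ?case
    by (intro exI[of _ "Poly_Mapping.single 0 c"]) (simp add: eval_entry_poly_single case_prod_beta)
next
  case (var v)
  have "(\<Prod>u\<in>UNIV. entries A u ^ Poly_Mapping.lookup (Poly_Mapping.single v 1) u)
      = (\<Prod>u\<in>UNIV. if v = u then entries A u else 1)" for A
    by (intro prod.cong) (auto simp: lookup_single when_def)
  then show ?case
    by (intro exI[of _ "Poly_Mapping.single (Poly_Mapping.single v 1) 1"])
      (simp add: eval_entry_poly_single case_prod_beta)
next
  case (add f g)
  then show ?case by (metis eval_entry_poly_add)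
next
  case (mult f g)
  then obtain P Q where P: "\<And>A. f (entries A) = eval_entry_poly P A"
    and Q: "\<And>A. g (entries A) = eval_entry_poly Q A" by blast
  define R where "R = (\<Sum>m\<in>Poly_Mapping.keys P. \<Sum>k\<in>Poly_Mapping.keys Q.
    Poly_Mapping.single (m + k) (Poly_Mapping.lookup P m * Poly_Mapping.lookup Q k))"
  have "eval_entry_poly R A = eval_entry_poly P A * eval_entry_poly Q A" for A
    unfolding R_def eval_entry_poly_sum eval_entry_poly_single eval_entry_poly_def[of P] eval_entry_poly_def[of Q] sum_product
    by (intro sum.cong refl)
      (simp add: lookup_add power_add prod.distrib case_prod_beta)
  then show ?case using P Q by metis
qed

text \<open>The bridge from analysis to generic statements.  Suppose that matrices \<open>A\<close> with the property
\<open>Q\<close> arise as solutions of a constructible condition \<open>C\<close> with auxiliary unknowns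
\<open>y\<close>, and that the condition is solvable for all \<open>A\<close> in some open set of the usual
topology.  Solvability is constructible in \<open>A\<close>, hence generically true or generically false;
the latter would make a nonzero polynomial vanish on an open set.\<close>

lemma generic_matrix_projection:
  fixes C :: "('n::finite \<times> 'n + 'w::finite \<Rightarrow> complex) \<Rightarrow> bool"
  assumes C: "constructible C"
    and U: "open U" "U \<noteq> {}" "\<And>A. A \<in> U \<Longrightarrow> \<exists>y. C (case_sum (entries A) y)"
    and Q: "\<And>A y. C (case_sum (entries A) y) \<Longrightarrow> Q A"
  shows "generic_matrix Q"
proof -
  let ?D = "\<lambda>e. \<exists>y. C (case_sum e y)"
  have ext_poly: "polyfun (\<lambda>e. case_sum e (\<lambda>_. 0) v)" for v :: "'n \<times> 'n + 'w"
    by (cases v) (simp_all add: polyfun.const polyfun.var)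
  have "constructible (\<lambda>e. \<exists>e'. (\<forall>v. v \<notin> range Inr \<longrightarrow> e' v = e v) \<and> C e')"
    by (intro constructible_projection C) simp
  then have "constructible (\<lambda>e. \<exists>e'. (\<forall>v. v \<notin> range Inr \<longrightarrow> e' v = case_sum e (\<lambda>_. 0) v) \<and> C e')"
    by (rule constructible_subst) (rule ext_poly)
  moreover have "(\<exists>e'. (\<forall>v. v \<notin> range Inr \<longrightarrow> e' v = case_sum e (\<lambda>_. 0) v) \<and> C e') \<longleftrightarrow> ?D e" for e
  proof
    assume "\<exists>e'. (\<forall>v. v \<notin> range Inr \<longrightarrow> e' v = case_sum e (\<lambda>_. 0) v) \<and> C e'"
    then obtain e' where e': "\<And>v. v \<notin> range Inr \<Longrightarrow> e' v = case_sum e (\<lambda>_. 0) v" "C e'" by blast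
    have "e' (Inl p) = e p" for p using e'(1)[of "Inl p"] by auto
    then have "e' = case_sum e (\<lambda>w. e' (Inr w))"
      by (auto simp: fun_eq_iff simp del: split_paired_All split: sum.split)
    then show "?D e" using e'(2) by metis
  next
    assume "?D e"
    then obtain y where "C (case_sum e y)" by blast
    then show "\<exists>e'. (\<forall>v. v \<notin> range Inr \<longrightarrow> e' v = case_sum e (\<lambda>_. 0) v) \<and> C e'"
      by (intro exI[of _ "case_sum e y"]) (auto split: sum.split)
  qed
  ultimately have D: "constructible ?D" by simp
  obtain g e0 where g: "polyfun g" "g e0 \<noteq> 0"
    "(\<forall>e. g e \<noteq> 0 \<longrightarrow> ?D e) \<or> (\<forall>e. g e \<noteq> 0 \<longrightarrow> \<not> ?D e)"
    using constructible_generically_constant[OF D] by blast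
  have "\<not> (\<forall>e. g e \<noteq> 0 \<longrightarrow> \<not> ?D e)"
    using polyfun_zero_on_open[OF g(1) U(1,2)] U(3) g(2) by blast
  then have gD: "\<And>e. g e \<noteq> 0 \<Longrightarrow> ?D e" using g(3) by blast
  obtain P where P: "\<And>A. g (entries A) = eval_entry_poly P A"
    using polyfun_as_entry_poly[OF g(1)] by blast
  let ?Z = "{A. \<forall>P\<in>{P}. eval_entry_poly P A = 0}"
  have "eval_entry_poly P (\<chi> p q. e0 (p, q)) \<noteq> 0"
    using P[of "\<chi> p q. e0 (p, q)"] g(2) by simp
  then have "?Z \<subset> UNIV" by auto
  moreover have "algebraic_subvariety ?Z" unfolding algebraic_subvariety_def by blast
  moreover have "A \<in> ?Z" if "\<not> Q A" for A
    using that gD[of "entries A"] Q P by auto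
  ultimately show ?thesis unfolding generic_matrix_def by blast
qed

section \<open>Roots of unity and cyclic shifts\<close>

type_synonym 'n cmatrix = "((complex, 'n) vec, 'n) vec"

text \<open>Positions counted from \<open>0\<close>, which is what the arithmetic modulo the dimension needs.\<close>

definition pos :: "'n::{finite,linorder} \<Rightarrow> nat" where
  "pos p = card {..<p}"

lemma index_pos_eq: "index_pos p = int (pos p) + 1"
proof -
  have "{..p} = insert p {..<p}" by auto
  then show ?thesis by (simp add: index_pos_def pos_def)
qed

lemma bij_betw_pos: "bij_betw pos (UNIV :: 'n::{finite,linorder} set) {..<CARD('n)}"
proof -
  have less: "pos p < pos q" if "p < q" for p q :: 'n
    unfolding pos_def using that by (intro psubset_card_mono) auto
  then have "inj (pos :: 'n \<Rightarrow> nat)"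
    by (intro injI) (metis less_irrefl linorder_less_linear)
  moreover have "pos p < CARD('n)" for p :: 'n
    unfolding pos_def by (intro psubset_card_mono) auto
  then have "range (pos :: 'n \<Rightarrow> nat) \<subseteq> {..<CARD('n)}" by auto
  ultimately show ?thesis
    by (simp add: bij_betw_def card_image card_subset_eq)
qed

definition index_at :: "int \<Rightarrow> 'n::{finite,linorder}" where
  "index_at m = inv pos (nat (m mod int CARD('n)))"

lemma pos_index_at: "int (pos (index_at m :: 'n::{finite,linorder})) = m mod int CARD('n)"
proof -
  have "nat (m mod int CARD('n)) \<in> pos ` (UNIV :: 'n set)"
    using bij_betw_pos[where 'n = 'n] by (auto simp: bij_betw_def nat_less_iff)
  then show ?thesis by (simp add: index_at_def f_inv_into_f)
qed

lemma pos_less: "pos (p :: 'n::{finite,linorder}) < CARD('n)"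
  using bij_betw_pos[where 'n = 'n] by (auto simp: bij_betw_def)

lemma eq_index_at_iff:
  "p = index_at m \<longleftrightarrow> [int (pos p) = m] (mod int CARD('n))" for p :: "'n::{finite,linorder}"
proof -
  have "p = index_at m \<longleftrightarrow> int (pos p) = int (pos (index_at m :: 'n))"
    using bij_betw_pos[where 'n = 'n] by (auto simp: bij_betw_def inj_eq)
  then show ?thesis
    using pos_less[of p] by (simp add: pos_index_at cong_def)
qed

lemma index_at_cong: "[m = m'] (mod int CARD('n)) \<Longrightarrow> index_at m = (index_at m' :: 'n::{finite,linorder})"
  by (simp add: index_at_def cong_def)

lemma index_at_pos: "index_at (int (pos p)) = (p :: 'n::{finite,linorder})"
  by (rule sym) (simp add: eq_index_at_iff)

definition zeta :: "nat \<Rightarrow> int \<Rightarrow> complex" where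
  "zeta N m = cis (2 * pi * of_int m / of_nat N)"

lemma zeta_add: "zeta N (a + b) = zeta N a * zeta N b"
  by (simp add: zeta_def cis_mult ring_distribs add_divide_distrib)

lemma zeta_nonzero [simp]: "zeta N a \<noteq> 0"
  by (simp add: zeta_def)

lemma zeta_powi: "zeta N a powi k = zeta N (a * k)"
  by (simp add: zeta_def cis_power_int mult_ac)

lemma zeta_power: "zeta N a ^ k = zeta N (a * int k)"
  using zeta_powi[of N a "int k"] by simp

lemma zeta_eq_1_iff:
  assumes "N > 0"
  shows "zeta N a = 1 \<longleftrightarrow> int N dvd a"
proof
  assume "zeta N a = 1"
  then obtain k :: int where "2 * pi * of_int a / of_nat N = of_int k * (2 * pi)"
    unfolding zeta_def cis_eq_1_iff by blast
  then have "real_of_int a = of_int (k * int N)"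
    using assms by (simp add: field_simps)
  then have "a = k * int N" by linarith
  then show "int N dvd a" by simp
next
  assume "int N dvd a"
  then obtain k where "a = int N * k" by blast
  then have "2 * pi * of_int a / of_nat N = of_int k * (2 * pi)"
    using assms by (simp add: field_simps)
  then show "zeta N a = 1"
    unfolding zeta_def cis_eq_1_iff by blast
qed

lemma sum_zeta:
  "(\<Sum>p\<in>(UNIV :: 'n::{finite,linorder} set). zeta CARD('n) (int (pos p) * m))
     = (if int CARD('n) dvd m then of_nat CARD('n) else 0)"
proof -
  let ?N = "CARD('n)" and ?z = "zeta CARD('n) m"
  have "(\<Sum>p\<in>(UNIV :: 'n set). zeta ?N (int (pos p) * m)) = (\<Sum>k<?N. ?z ^ k)"
    using sum.reindex_bij_betw[OF bij_betw_pos, of "\<lambda>k. zeta ?N (int k * m)"]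
    by (simp add: zeta_power mult.commute)
  also have "\<dots> = (if int ?N dvd m then of_nat ?N else 0)"
  proof (cases "int ?N dvd m")
    case True
    then have "?z = 1" by (simp add: zeta_eq_1_iff)
    then show ?thesis using True by simp
  next
    case False
    then have "?z \<noteq> 1" by (simp add: zeta_eq_1_iff)
    moreover have "?z ^ ?N = 1" by (simp add: zeta_power zeta_eq_1_iff)
    ultimately show ?thesis using False by (simp add: sum_gp_strict)
  qed
  finally show ?thesis .
qed

lemma fourier_inversion:
  fixes g :: "'n::{finite,linorder} \<Rightarrow> complex"
  shows "(\<Sum>k\<in>(UNIV :: 'n set). (\<Sum>r\<in>UNIV. g r * zeta CARD('n) (- (int (pos k) * int (pos r))))
      / of_nat CARD('n) * zeta CARD('n) (int (pos k) * t)) = g (index_at t)"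
proof -
  let ?N = "CARD('n)"
  have "(\<Sum>k\<in>(UNIV :: 'n set). (\<Sum>r\<in>UNIV. g r * zeta ?N (- (int (pos k) * int (pos r))))
      / of_nat ?N * zeta ?N (int (pos k) * t))
    = (\<Sum>k\<in>(UNIV :: 'n set). \<Sum>r\<in>UNIV. g r / of_nat ?N * zeta ?N (int (pos k) * (t - int (pos r))))"
    by (intro sum.cong refl)
      (simp add: sum_divide_distrib sum_distrib_right right_diff_distrib zeta_add[symmetric] mult.assoc
        flip: times_divide_eq_left)
  also have "\<dots> = (\<Sum>r\<in>UNIV. g r / of_nat ?N * (\<Sum>k\<in>(UNIV :: 'n set). zeta ?N (int (pos k) * (t - int (pos r)))))"
    by (subst sum.swap) (simp add: sum_distrib_left)
  also have "\<dots> = (\<Sum>r\<in>UNIV. if r = index_at t then g r else 0)"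
    by (intro sum.cong refl) (auto simp: sum_zeta eq_index_at_iff cong_iff_dvd_diff dvd_diff_commute)
  also have "\<dots> = g (index_at t)" by simp
  finally show ?thesis .
qed

definition cyclic_shift :: "int \<Rightarrow> 'n::{finite,linorder} cmatrix" where
  "cyclic_shift k = (\<chi> p q. if [int (pos p) + k = int (pos q)] (mod int CARD('n)) then 1 else 0)"

lemma cyclic_shift_mult:
  fixes X :: "'n::{finite,linorder} cmatrix"
  shows "(cyclic_shift k ** X) $ p $ q = X $ index_at (int (pos p) + k) $ q"
proof -
  have "(cyclic_shift k ** X) $ p $ q = (\<Sum>r\<in>UNIV. if r = index_at (int (pos p) + k) then X $ r $ q else 0)"
    unfolding matrix_matrix_mult_def cyclic_shift_def vec_lambda_beta
    by (intro sum.cong refl) (auto simp: eq_index_at_iff cong_sym_eq)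
  then show ?thesis by simp
qed

lemma mult_cyclic_shift:
  fixes X :: "'n::{finite,linorder} cmatrix"
  shows "(X ** cyclic_shift k) $ p $ q = X $ p $ index_at (int (pos q) - k)"
proof -
  have *: "[int (pos r) + k = int (pos q)] (mod int CARD('n)) \<longleftrightarrow> r = index_at (int (pos q) - k)" for r :: 'n
    by (simp add: eq_index_at_iff cong_iff_dvd_diff algebra_simps)
  have "(X ** cyclic_shift k) $ p $ q = (\<Sum>r\<in>UNIV. if r = index_at (int (pos q) - k) then X $ p $ r else 0)"
    unfolding matrix_matrix_mult_def cyclic_shift_def vec_lambda_beta
    by (intro sum.cong refl) (auto simp: *)
  then show ?thesis by simp
qed

lemma cyclic_shift_add:
  "cyclic_shift j ** cyclic_shift k = (cyclic_shift (j + k) :: 'n::{finite,linorder} cmatrix)"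
proof -
  have "[int (pos (index_at (int (pos p) + j) :: 'n)) + k = int (pos q)] (mod int CARD('n))
    \<longleftrightarrow> [int (pos p) + (j + k) = int (pos q)] (mod int CARD('n))" for p q :: 'n
    unfolding pos_index_at by (simp add: cong_def mod_simps add.assoc)
  then show ?thesis
    unfolding vec_eq_iff cyclic_shift_mult by (simp add: cyclic_shift_def)
qed

lemma cyclic_shift_0: "cyclic_shift 0 = (mat 1 :: 'n::{finite,linorder} cmatrix)"
proof -
  have "[int (pos p) = int (pos q)] (mod int CARD('n)) \<longleftrightarrow> p = q" for p q :: 'n
    using eq_index_at_iff[of p "int (pos q)"] eq_index_at_iff[of q "int (pos q)"] by simp
  then show ?thesis by (simp add: vec_eq_iff cyclic_shift_def mat_def)
qed

definition fourier_nodes :: "complex ^ 'n::{finite,linorder}" where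
  "fourier_nodes = (\<chi> k. zeta CARD('n) (int (pos k)))"

text \<open>The transposed Vandermonde matrix at the complex conjugate nodes; up to a scalar and a cyclic shift it
is the inverse of the Vandermonde matrix at \<open>fourier_nodes\<close>.\<close>

definition inv_fourier :: "int \<Rightarrow> 'n::{finite,linorder} cmatrix" where
  "inv_fourier b = transpose (gen_vandermonde b (\<chi> k. zeta CARD('n) (- int (pos k))))"

lemma inv_fourier_nth:
  "(inv_fourier b :: 'n::{finite,linorder} cmatrix) $ p $ q
     = zeta CARD('n) (- (int (pos p) * (b + int (pos q))))"
  by (simp add: inv_fourier_def transpose_def gen_vandermonde_def index_pos_eq zeta_powi)

lemma inv_fourier_in_Vand_transpose: "inv_fourier b \<in> Vand_transpose b"
  unfolding inv_fourier_def Vand_transpose_def Vand_def by (intro imageI CollectI exI conjI refl) auto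

text \<open>The entry at \<open>(p, q)\<close> is the sum of the powers of a root of unity with exponent
\<open>p + a - b - q\<close>, which vanishes unless the exponent is divisible by the dimension.\<close>

lemma fourier_mult_inv_fourier:
  "gen_vandermonde a fourier_nodes ** inv_fourier b
     = real CARD('n) *\<^sub>R (cyclic_shift (a - b) :: 'n::{finite,linorder} cmatrix)"
proof -
  let ?N = "CARD('n)"
  have "(gen_vandermonde a fourier_nodes ** inv_fourier b :: 'n cmatrix) $ p $ q
      = (real ?N *\<^sub>R cyclic_shift (a - b) :: 'n cmatrix) $ p $ q" for p q
  proof -
    have "(gen_vandermonde a fourier_nodes ** inv_fourier b :: 'n cmatrix) $ p $ q
      = (\<Sum>k\<in>(UNIV :: 'n set). zeta ?N (int (pos k) * (int (pos p) + (a - b) - int (pos q))))"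
      unfolding matrix_matrix_mult_def
      by (simp add: gen_vandermonde_def fourier_nodes_def inv_fourier_nth index_pos_eq zeta_powi
          zeta_add[symmetric] algebra_simps)
    then show ?thesis
      by (simp add: sum_zeta cyclic_shift_def cong_iff_dvd_diff scaleR_conv_of_real[where 'a = complex])
  qed
  then show ?thesis by (simp add: vec_eq_iff)
qed

section \<open>The derivative of a product of Vandermonde matrices\<close>

lemma has_derivative_vecI:
  fixes f :: "'a::euclidean_space \<Rightarrow> 'b::euclidean_space ^ 'n"
  assumes "\<And>i. ((\<lambda>x. f x $ i) has_derivative (\<lambda>h. f' h $ i)) (at x)"
  shows "(f has_derivative f') (at x)"
  unfolding has_derivative_componentwise_within[of f]
proof
  fix b :: "'b ^ 'n" assume "b \<in> Basis"
  then obtain i c where b: "b = axis i c" by (auto simp: Basis_vec_def)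
  show "((\<lambda>x. f x \<bullet> b) has_derivative (\<lambda>x. f' x \<bullet> b)) (at x)"
    unfolding b inner_axis by (intro has_derivative_inner_left assms)
qed

lemma bounded_bilinear_matrix_mult:
  "bounded_bilinear ((**) :: complex ^ 'n ^ 'm \<Rightarrow> complex ^ 'k ^ 'n \<Rightarrow> complex ^ 'k ^ 'm)"
  unfolding bilinear_conv_bounded_bilinear[symmetric] bilinear_def
  by (auto intro!: linearI simp: vec_eq_iff matrix_matrix_mult_def distrib_left distrib_right
      sum.distrib scaleR_sum_right)

abbreviation matrix_prod :: "('i \<Rightarrow> complex ^ 'n ^ 'n) \<Rightarrow> 'i list \<Rightarrow> complex ^ 'n ^ 'n::finite" where
  "matrix_prod G is \<equiv> foldr (\<lambda>i B. G i ** B) is (mat 1)"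

lemma has_derivative_matrix_prod:
  fixes G :: "'i \<Rightarrow> 'a::real_normed_vector \<Rightarrow> complex ^ 'n ^ 'n"
  assumes "\<And>i. i \<in> set is \<Longrightarrow> (G i has_derivative G' i) (at x)"
  shows "((\<lambda>x. matrix_prod (\<lambda>i. G i x) is) has_derivative
     (\<lambda>h. \<Sum>j<length is. matrix_prod (\<lambda>i. G i x) (take j is) ** G' (is ! j) h **
        matrix_prod (\<lambda>i. G i x) (drop (Suc j) is))) (at x)"
  using assms
proof (induction "is")
  case Nil
  show ?case by simp
next
  case (Cons i "is")
  note der = bounded_bilinear.FDERIV[OF bounded_bilinear_matrix_mult Cons.prems[of i] Cons.IH]
  show ?case
    by (rule has_derivative_eq_rhs, simp, rule der)
      (auto simp: sum.lessThan_Suc_shift fun_eq_iff matrix_mul_assoc matrix_add_ldistrib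
        bounded_bilinear.sum_right[OF bounded_bilinear_matrix_mult] Cons.prems
        simp del: sum.lessThan_Suc)
qed

lemma has_derivative_gen_vandermonde:
  fixes X :: "'n::{finite,linorder} cmatrix"
  assumes "\<And>k. X $ i $ k \<noteq> 0"
  shows "((\<lambda>X. gen_vandermonde m (X $ i)) has_derivative
     (\<lambda>H. \<chi> p q. of_int (m + int (pos p)) * (X $ i $ q) powi (m + int (pos p) - 1) * H $ i $ q)) (at X)"
proof (intro has_derivative_vecI)
  fix p q :: 'n
  have "((\<lambda>X. X $ i $ q) has_derivative (\<lambda>H. H $ i $ q)) (at X)" for X :: "'n cmatrix"
    by (intro bounded_linear.has_derivative[OF bounded_linear_vec_nth] has_derivative_ident)
  from has_derivative_power_int[OF assms this, of "m + int (pos p)"]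
  show "((\<lambda>X. gen_vandermonde m (X $ i) $ p $ q) has_derivative
      (\<lambda>H. (\<chi> p q. of_int (m + int (pos p)) * (X $ i $ q) powi (m + int (pos p) - 1) * H $ i $ q) $ p $ q)) (at X)"
    by (simp add: gen_vandermonde_def index_pos_eq algebra_simps)
qed

text \<open>The nodes move in direction \<open>fourier_nodes $ k * \<beta> k\<close>, that is, \<open>\<beta>\<close> is the
logarithmic velocity.  The entry at \<open>(p, q)\<close> is then the exponent in row \<open>p\<close> times a
Fourier transform of \<open>\<beta>\<close> at a frequency depending on \<open>p - q\<close> only: the contribution
is a diagonal matrix times a circulant matrix.\<close>

lemma gen_vandermonde_derivative_at_fourier_nodes:
  fixes \<beta> :: "'n::{finite,linorder} \<Rightarrow> complex"
  shows "((\<chi> p k. of_int (a + int (pos p)) * (fourier_nodes $ k) powi (a + int (pos p) - 1)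
        * (fourier_nodes $ k * \<beta> k)) ** inv_fourier b :: 'n cmatrix) $ p $ q
     = of_int (a + int (pos p)) *
       (\<Sum>k\<in>UNIV. \<beta> k * zeta CARD('n) (int (pos k) * (a - b + int (pos p) - int (pos q))))"
proof -
  have "zeta CARD('n) (int (pos k)) powi (a + int (pos p) - 1) * zeta CARD('n) (int (pos k))
      * zeta CARD('n) (- (int (pos k) * (b + int (pos q))))
    = zeta CARD('n) (int (pos k) * (a - b + int (pos p) - int (pos q)))" for k :: 'n
    by (simp add: zeta_powi zeta_add[symmetric] algebra_simps)
  then show ?thesis
    unfolding matrix_matrix_mult_def
    by (simp add: fourier_nodes_def inv_fourier_nth sum_distrib_left mult_ac)
qed

lemma matrix_prod_cyclic_shift:
  "matrix_prod (\<lambda>i. real N *\<^sub>R cyclic_shift (c i)) is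
     = real N ^ length is *\<^sub>R (cyclic_shift (\<Sum>i\<leftarrow>is. c i) :: 'n::{finite,linorder} cmatrix)"
  by (induction "is") (simp_all add: cyclic_shift_0 cyclic_shift_add
      bounded_bilinear.scaleR_left[OF bounded_bilinear_matrix_mult]
      bounded_bilinear.scaleR_right[OF bounded_bilinear_matrix_mult])

text \<open>The diagonals that occur in the derivative span all diagonals.  For \<open>N \<ge> 2\<close> the shifts in the
last two rows coincide, so the difference of these rows is a nonzero constant.  Modulo constants,
two consecutive sawtooth functions \<open>(p + j) mod N\<close> differ by a nonzero multiple of the unit vector
at the point \<open>N - 1 - j\<close> where the tooth drops, which yields the unit vectors at
\<open>2, \<dots>, N - 1\<close>.  Row \<open>0\<close> and the constants supply the remaining two.\<close>

lemma sawtooth_span: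
  fixes \<sigma> :: "nat \<Rightarrow> int" and m :: "nat \<Rightarrow> complex"
  assumes "N > 0" and one: "N = 1 \<Longrightarrow> \<sigma> 0 \<noteq> 0"
    and two: "N \<ge> 2 \<Longrightarrow> \<sigma> (N - 1) \<noteq> \<sigma> (N - 2)"
  shows "\<exists>g. \<forall>p<N. (\<Sum>j<N. of_int (\<sigma> j + (int p + int (min j (N - 2))) mod int N) * g j) = m p"
proof -
  define row where "row j p = (of_int (\<sigma> j + (int p + int (min j (N - 2))) mod int N) :: complex)" for j p
  define S where "S = {m. \<exists>g. \<forall>p<N. (\<Sum>j<N. row j p * g j) = m p}"
  have cong: "m' \<in> S" if "m \<in> S" "\<And>p. p < N \<Longrightarrow> m' p = m p" for m m'
    using that by (auto simp: S_def)
  have scale: "(\<lambda>p. c * m p) \<in> S" if m: "m \<in> S" for c m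
  proof -
    obtain g where "\<forall>p<N. (\<Sum>j<N. row j p * g j) = m p" using m by (auto simp: S_def)
    moreover have "(\<Sum>j<N. row j p * (c * g j)) = c * (\<Sum>j<N. row j p * g j)" for p
      unfolding sum_distrib_left by (intro sum.cong refl mult.left_commute)
    ultimately show ?thesis
      unfolding S_def by (intro CollectI exI[of _ "\<lambda>j. c * g j"]) simp
  qed
  have add: "(\<lambda>p. m p + m' p) \<in> S" if m: "m \<in> S" "m' \<in> S" for m m'
  proof -
    obtain g g' where "\<forall>p<N. (\<Sum>j<N. row j p * g j) = m p" "\<forall>p<N. (\<Sum>j<N. row j p * g' j) = m' p"
      using m by (auto simp: S_def)
    then have "\<forall>p<N. (\<Sum>j<N. row j p * (g j + g' j)) = m p + m' p"
      by (simp add: distrib_left sum.distrib)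
    then show ?thesis unfolding S_def by (intro CollectI exI[of _ "\<lambda>j. g j + g' j"])
  qed
  have diff: "(\<lambda>p. m p - m' p) \<in> S" if "m \<in> S" "m' \<in> S" for m m'
    using add[OF that(1) scale[OF that(2), of "-1"]] by simp
  have zero: "(\<lambda>p. 0) \<in> S"
    unfolding S_def by (auto intro: exI[of _ "\<lambda>_. 0"])
  have sum: "(\<lambda>p. \<Sum>k\<in>K. f k p) \<in> S" if "\<And>k. k \<in> K \<Longrightarrow> f k \<in> S" for f and K :: "nat set"
    using that by (induction K rule: infinite_finite_induct) (auto intro: zero add)
  have row: "row j \<in> S" if "j < N" for j
  proof -
    have "\<forall>p<N. (\<Sum>i<N. row i p * (if i = j then 1 else 0)) = row j p"
      using that by (simp add: if_distrib[of "\<lambda>x. _ * x"] cong: if_cong)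
    then show ?thesis unfolding S_def by (intro CollectI exI[of _ "\<lambda>i. if i = j then 1 else 0"])
  qed
  let ?e = "\<lambda>k p. if p = k then 1 else (0 :: complex)"
  have "?e k \<in> S" if "k < N" for k
  proof (cases "N = 1")
    case True
    have "(\<lambda>p. inverse (of_int (\<sigma> 0)) * row 0 p) \<in> S" using row[of 0] True by (intro scale) simp
    then show ?thesis using True that one by (elim cong) (auto simp: row_def)
  next
    case False
    with \<open>N > 0\<close> have N: "N \<ge> 2" by simp
    have "(\<lambda>p. inverse (of_int (\<sigma> (N - 1) - \<sigma> (N - 2))) * (row (N - 1) p - row (N - 2) p)) \<in> S"
      using N by (intro scale diff row) auto
    moreover have "min (N - 1) (N - 2) = N - 2" by simp
    ultimately have "(\<lambda>p. 1) \<in> S"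
      using two[OF N] by (elim cong) (simp add: row_def)
    then have const: "(\<lambda>p. c) \<in> S" for c
      using scale[of "\<lambda>p. 1" c] by simp
    have unit: "?e k \<in> S" if k: "2 \<le> k" "k < N" for k
    proof -
      \<comment> \<open>The position where sawtooth \<open>j\<close> drops is \<open>k\<close>.\<close>
      define j where "j = N - 1 - k"
      have j: "j + k = N - 1" "Suc j \<le> N - 2" using k by (auto simp: j_def)
      have step: "row (Suc j) p - row j p = of_int (\<sigma> (Suc j) - \<sigma> j) + 1 - of_nat N * ?e k p" if "p < N" for p
      proof -
        have "int ((p + Suc j) mod N) - int ((p + j) mod N) = 1 - int N * (if p = k then 1 else 0)"
        proof (cases "p = k")
          case True
          then have "p + j = N - 1" "p + Suc j = N" using j k by auto
          then show ?thesis using True \<open>N > 0\<close> by (simp add: of_nat_diff)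
        next
          case False
          have "Suc ((p + j) mod N) \<noteq> N"
          proof
            assume "Suc ((p + j) mod N) = N"
            moreover have "(p + j) mod N = (if p + j < N then p + j else p + j - N)"
              using that j by (auto simp: mod_if)
            ultimately show False using False j that k by (auto split: if_splits)
          qed
          then show ?thesis using False by (simp add: mod_Suc)
        qed
        then have "(int p + int (Suc j)) mod int N - (int p + int j) mod int N
            = 1 - int N * (if p = k then 1 else 0)"
          by (simp only: zmod_int of_nat_add)
        moreover have "min (Suc j) (N - 2) = Suc j" "min j (N - 2) = j" using j by auto
        ultimately have "row (Suc j) p - row j p
            = of_int (\<sigma> (Suc j) - \<sigma> j + (1 - int N * (if p = k then 1 else 0)))"
          unfolding row_def of_int_diff[symmetric] by (intro arg_cong[of _ _ of_int]) linarith
        then show ?thesis by simp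
      qed
      have "(\<lambda>p. inverse (of_nat N) *
          ((of_int (\<sigma> (Suc j) - \<sigma> j) + 1) - (row (Suc j) p - row j p))) \<in> S"
        using j N by (intro scale diff row const) auto
      then show ?thesis
        using \<open>N > 0\<close> by (elim cong) (simp add: step)
    qed
    have "(\<lambda>p. row 0 p - of_int (\<sigma> 0) - (\<Sum>k\<in>{2..<N}. of_nat k * ?e k p)) \<in> S"
      using N by (intro diff sum row const scale unit) auto
    moreover have "row 0 p - of_int (\<sigma> 0) - (\<Sum>k\<in>{2..<N}. of_nat k * ?e k p) = ?e 1 p" if "p < N" for p
    proof -
      have "(\<Sum>k\<in>{2..<N}. of_nat k * ?e k p) = (if p \<in> {2..<N} then of_nat p else 0)"
      proof -
        have "(\<Sum>k\<in>{2..<N}. of_nat k * ?e k p) = (\<Sum>k\<in>{2..<N}. if p = k then of_nat k else 0)"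
          by (intro sum.cong refl) simp
        then show ?thesis by (simp only: sum.delta' finite_atLeastLessThan)
      qed
      then show ?thesis using that N by (auto simp: row_def)
    qed
    ultimately have unit1: "?e 1 \<in> S" by (elim cong) simp
    have pos_unit: "?e k \<in> S" if "k \<in> {1..<N}" for k
      using that unit[of k] unit1 by (cases "k = 1") auto
    have "(\<lambda>p. 1 - (\<Sum>k\<in>{1..<N}. ?e k p)) \<in> S"
      by (intro diff sum const pos_unit)
    moreover have "1 - (\<Sum>k\<in>{1..<N}. ?e k p) = ?e 0 p" if "p < N" for p
      using that by (simp add: sum.delta)
    ultimately have "?e 0 \<in> S" by (elim cong) simp
    then show ?thesis using pos_unit[of k] that by (cases "k = 0") auto
  qed
  then have "(\<lambda>p. \<Sum>k\<in>{..<N}. m k * ?e k p) \<in> S" by (intro sum scale) auto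
  then have "m \<in> S"
    by (elim cong) (simp add: if_distrib[of "\<lambda>x. _ * x"] cong: if_cong)
  then show ?thesis unfolding S_def row_def by simp
qed

section \<open>Ordering the factors\<close>

text \<open>The numbers \<open>s i\<close> form a complete residue system, so there is an index \<open>\<rho> r\<close> for every
residue \<open>r\<close>.  Pairing \<open>\<rho> (l + 1)\<close> with \<open>\<rho> l\<close> makes every partial sum grow by
\<open>1\<close> modulo the dimension.  Exchanging the last two partners makes the step at \<open>N - 2\<close>
equal to \<open>0\<close>, so that exactly the last two of the partial sums below \<open>N\<close> agree.  For
\<open>N = 1\<close> the truncated subtraction turns the transposition into the identity.\<close>

lemma exists_pairing:
  fixes s :: "'n::{finite,linorder} \<Rightarrow> int"
  assumes incong: "\<And>i j. i \<noteq> j \<Longrightarrow> \<not> [s i = s j] (mod int CARD('n))"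
  obtains a b where "bij_betw a {..<CARD('n)} UNIV" "bij_betw b {..<CARD('n)} UNIV"
    "\<And>j. j < CARD('n) \<Longrightarrow>
       [(\<Sum>i<j. s (a i) - s (b i)) = int (min j (CARD('n) - 2))] (mod int CARD('n))"
proof -
  let ?N = "CARD('n)"
  let ?res = "\<lambda>i. nat (s i mod int ?N)"
  have "inj ?res"
    using incong by (intro injI) (metis cong_def eq_nat_nat_iff pos_mod_sign of_nat_0_less_iff zero_less_card_finite)
  moreover have "range ?res \<subseteq> {..<?N}" by (auto simp: nat_less_iff)
  ultimately have bij_res: "bij_betw ?res UNIV {..<?N}"
    by (simp add: bij_betw_def card_image card_subset_eq)
  define \<rho> where "\<rho> = inv_into UNIV ?res"
  have bij_\<rho>: "bij_betw \<rho> {..<?N} UNIV"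
    unfolding \<rho>_def by (rule bij_betw_inv_into[OF bij_res])
  have s_\<rho>: "[s (\<rho> r) = int r] (mod int ?N)" if "r < ?N" for r
  proof -
    have "?res (\<rho> r) = r"
      unfolding \<rho>_def using bij_betw_inv_into_right[OF bij_res, of r] that by simp
    then have "s (\<rho> r) mod int ?N = int r" by (metis nat_0_le pos_mod_sign of_nat_0_less_iff zero_less_card_finite)
    then show ?thesis using that by (simp add: cong_def)
  qed
  define a where "a l = \<rho> (Suc l mod ?N)" for l
  define b where "b l = \<rho> (Transposition.transpose (?N - 2) (?N - 1) l)" for l
  have "bij_betw (\<lambda>l. Suc l mod ?N) {..<?N} {..<?N}"
  proof -
    have "inj_on (\<lambda>l. Suc l mod ?N) {..<?N}"
      by (intro inj_onI) (auto simp: mod_Suc split: if_splits)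
    moreover have "(\<lambda>l. Suc l mod ?N) ` {..<?N} \<subseteq> {..<?N}" by auto
    ultimately show ?thesis by (simp add: bij_betw_def endo_inj_surj)
  qed
  then have "bij_betw a {..<?N} UNIV"
    using bij_betw_trans[OF _ bij_\<rho>] by (simp add: a_def[abs_def] comp_def)
  moreover have "bij_betw (Transposition.transpose (?N - 2) (?N - 1)) {..<?N} {..<?N}"
    by (intro permutes_imp_bij permutes_swap_id) (auto simp: not_le)
  from bij_betw_trans[OF this bij_\<rho>] have "bij_betw b {..<?N} UNIV"
    by (simp only: b_def[abs_def] comp_def)
  moreover have "[(\<Sum>i<j. s (a i) - s (b i)) = int (min j (?N - 2))] (mod int ?N)" if j: "j < ?N" for j
  proof -
    have small: "[(\<Sum>i<k. s (a i) - s (b i)) = int k] (mod int ?N)" if "k \<le> ?N - 2" "k < ?N" for k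
      using that
    proof (induction k)
      case 0
      show ?case by simp
    next
      case (Suc k)
      then have "a k = \<rho> (Suc k)" "b k = \<rho> k" by (auto simp: a_def b_def)
      then have "[s (a k) - s (b k) = int (Suc k) - int k] (mod int ?N)"
        using Suc.prems by (simp only:) (intro cong_diff s_\<rho>, auto)
      from cong_add[OF Suc.IH this] show ?case using Suc.prems by (simp add: add.commute)
    qed
    show ?thesis
    proof (cases "j \<le> ?N - 2")
      case True
      then show ?thesis using small j by simp
    next
      case False
      then have k: "j = Suc (?N - 2)" "Suc (?N - 2) = ?N - 1" using j by auto
      then have "a (?N - 2) = b (?N - 2)" using j by (simp add: a_def b_def)
      then show ?thesis using small[of "?N - 2"] j unfolding k(1) by simp
    qed
  qed
  ultimately show ?thesis by (rule that)
qed

section \<open>Products of Vandermonde matrices fill an open set\<close>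

definition nonvanishing :: "(complex ^ 'n ^ 'm) set" where
  "nonvanishing = {X. \<forall>i k. X $ i $ k \<noteq> 0}"

lemma open_nonvanishing: "open (nonvanishing :: (complex ^ 'n ^ 'm) set)"
proof -
  have "nonvanishing = (\<Inter>i\<in>UNIV. \<Inter>k\<in>UNIV. {X :: complex ^ 'n ^ 'm. X $ i $ k \<noteq> 0})"
    by (auto simp: nonvanishing_def)
  also have "open \<dots>"
    by (intro open_INT ballI finite open_Collect_neq continuous_intros)
  finally show ?thesis .
qed

text \<open>At the Fourier nodes the derivative is onto.  There every pair of factors is a multiple of a cyclic
shift, so the contribution of pair \<open>j\<close> to the entry at \<open>(p, q)\<close> is, up to a common factor,
\<open>s (a j) + (p + K j) mod N\<close> times an arbitrary function \<open>g j\<close> of the residue of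
\<open>T + p - q\<close>, where \<open>K j\<close> is the sum of the shifts before pair \<open>j\<close> and \<open>T\<close>
the sum of all shifts.  For each residue separately, hitting a prescribed matrix is the linear system
solved by \<open>sawtooth_span\<close>.\<close>

lemma interior_vandermonde_products:
  fixes s :: "'n::{finite,linorder} \<Rightarrow> int" and a b :: "nat \<Rightarrow> 'n"
  defines "\<Phi> \<equiv> \<lambda>X :: 'n cmatrix. matrix_prod
      (\<lambda>l. gen_vandermonde (s (a l)) (X $ a l) ** inv_fourier (s (b l))) [0..<CARD('n)]"
  assumes a: "bij_betw a {..<CARD('n)} UNIV"
    and K: "\<And>j. j < CARD('n) \<Longrightarrow>
       [(\<Sum>i<j. s (a i) - s (b i)) = int (min j (CARD('n) - 2))] (mod int CARD('n))"
    and one: "CARD('n) = 1 \<Longrightarrow> s (a 0) \<noteq> 0"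
    and inj: "inj s"
  shows "interior (\<Phi> ` nonvanishing) \<noteq> {}"
proof -
  let ?N = "CARD('n)"
  define c where "c i = s (a i) - s (b i)" for i
  define G' :: "_ \<Rightarrow> _ \<Rightarrow> _ \<Rightarrow> 'n cmatrix" where "G' X l H = (\<chi> p q. of_int (s (a l) + int (pos p)) * (X $ a l $ q) powi (s (a l) + int (pos p) - 1)
      * H $ a l $ q) ** inv_fourier (s (b l))" for X H :: "'n cmatrix" and l
  define G where "G X l = gen_vandermonde (s (a l)) (X $ a l) ** inv_fourier (s (b l))" for X :: "'n cmatrix" and l
  define D where "D X H = (\<Sum>j<length [0..<?N]. matrix_prod (G X) (take j [0..<?N]) ** G' X ([0..<?N] ! j) H **
      matrix_prod (G X) (drop (Suc j) [0..<?N]))" for X H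
  have der: "(\<Phi> has_derivative D X) (at X)" if "X \<in> nonvanishing" for X
  proof -
    have "((\<lambda>X. G X l) has_derivative G' X l) (at X)" for l
    proof -
      have "bounded_linear (\<lambda>A. A ** inv_fourier (s (b l)) :: 'n cmatrix)"
        by (rule bounded_bilinear.bounded_linear_left[OF bounded_bilinear_matrix_mult])
      from bounded_linear.has_derivative[OF this has_derivative_gen_vandermonde[of X "a l"]]
      show ?thesis using that unfolding G_def G'_def nonvanishing_def by blast
    qed
    then show ?thesis
      unfolding \<Phi>_def D_def G_def[symmetric] by (rule has_derivative_matrix_prod)
  qed
  define X0 :: "'n cmatrix" where "X0 = (\<chi> i. fourier_nodes)"
  have X0: "X0 \<in> nonvanishing" by (simp add: X0_def nonvanishing_def fourier_nodes_def)
  have G_X0: "G X0 = (\<lambda>l. real ?N *\<^sub>R cyclic_shift (c l))"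
    by (intro ext) (simp add: G_def X0_def c_def fourier_mult_inv_fourier)
  define T where "T = (\<Sum>i<?N. c i)"
  have D_nth: "D X0 H $ p $ q = of_nat ?N ^ (?N - 1) * (\<Sum>j<?N.
      G' X0 j H $ index_at (int (pos p) + (\<Sum>i<j. c i)) $ index_at (int (pos q) - (\<Sum>i\<in>{Suc j..<?N}. c i)))" for H p q
  proof -
    have "(matrix_prod (G X0) (take j [0..<?N]) ** G' X0 ([0..<?N] ! j) H **
        matrix_prod (G X0) (drop (Suc j) [0..<?N])) $ p $ q = of_nat ?N ^ (?N - 1) *
      G' X0 j H $ index_at (int (pos p) + (\<Sum>i<j. c i)) $ index_at (int (pos q) - (\<Sum>i\<in>{Suc j..<?N}. c i))"
      if "j < ?N" for j
    proof -
      have "?N - 1 = j + (?N - Suc j)" using that by simp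
      then have pow: "(of_nat ?N :: complex) ^ (?N - 1) = of_nat ?N ^ j * of_nat ?N ^ (?N - Suc j)"
        by (simp only: power_add)
      show ?thesis
        unfolding pow G_X0 matrix_prod_cyclic_shift
        using that by (simp add: bounded_bilinear.scaleR_left[OF bounded_bilinear_matrix_mult]
          bounded_bilinear.scaleR_right[OF bounded_bilinear_matrix_mult]
          interv_sum_list_conv_sum_set_nat mult_cyclic_shift cyclic_shift_mult
          scaleR_conv_of_real[where 'a = complex] atLeast0LessThan mult_ac)
    qed
    then show ?thesis
      unfolding D_def sum_component by (simp add: sum_distrib_left)
  qed
  have "surj (D X0)"
  proof (rule surjI)
    fix M :: "'n cmatrix"
    \<comment> \<open>The wanted entries, sorted by the residue \<open>r\<close> of \<open>T + p - q\<close>.\<close>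
    define m where "m r p = M $ index_at (int p) $ index_at (T + int p - int (pos r)) / of_nat ?N ^ (?N - 1)"
      for r :: 'n and p
    define solves where "solves r g \<longleftrightarrow> (\<forall>p<?N.
        (\<Sum>j<?N. of_int (s (a j) + (int p + int (min j (?N - 2))) mod int ?N) * g j) = m r p)" for r g
    have "\<exists>g. solves r g" for r
      unfolding solves_def
    proof (rule sawtooth_span)
      assume "?N \<ge> 2"
      then have "a (?N - 1) \<noteq> a (?N - 2)"
        using a by (auto simp: bij_betw_def dest: inj_onD)
      then show "s (a (?N - 1)) \<noteq> s (a (?N - 2))" using inj by (simp add: inj_eq)
    qed (use one in auto)
    then obtain g where "\<And>r. solves r (g r)" by metis
    then have g: "(\<Sum>j<?N. of_int (s (a j) + (int p + int (min j (?N - 2))) mod int ?N) * g r j) = m r p"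
      if "p < ?N" for r p
      using that unfolding solves_def by blast
    \<comment> \<open>The velocities whose Fourier transform is the given function of the residue.\<close>
    define \<beta> where "\<beta> j k = (\<Sum>r\<in>UNIV. g r j * zeta ?N (- (int (pos k) * int (pos r)))) / of_nat ?N" for j and k :: 'n
    define H :: "'n cmatrix" where "H = (\<chi> i k. fourier_nodes $ k * \<beta> (inv_into {..<?N} a i) k)"
    have G'_H: "G' X0 j H $ p $ q = of_int (s (a j) + int (pos p)) * g (index_at (c j + int (pos p) - int (pos q))) j"
      if "j < ?N" for j p q
    proof -
      have "inv_into {..<?N} a (a j) = j"
        using a that by (intro inv_into_f_f) (auto simp: bij_betw_def)
      then have "G' X0 j H = (\<chi> p k. of_int (s (a j) + int (pos p)) * (fourier_nodes $ k) powi (s (a j) + int (pos p) - 1)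
        * (fourier_nodes $ k * \<beta> j k)) ** inv_fourier (s (b j))"
        by (simp add: G'_def X0_def H_def)
      then show ?thesis
        by (simp only: gen_vandermonde_derivative_at_fourier_nodes \<beta>_def fourier_inversion c_def)
    qed
    have "D X0 H $ p $ q = M $ p $ q" for p q
    proof -
      let ?r = "index_at (T + int (pos p) - int (pos q)) :: 'n"
      have "D X0 H $ p $ q = of_nat ?N ^ (?N - 1) * (\<Sum>j<?N.
          of_int (s (a j) + (int (pos p) + int (min j (?N - 2))) mod int ?N) * g ?r j)"
      proof -
        have "G' X0 j H $ index_at (int (pos p) + (\<Sum>i<j. c i)) $ index_at (int (pos q) - (\<Sum>i\<in>{Suc j..<?N}. c i))
          = of_int (s (a j) + (int (pos p) + int (min j (?N - 2))) mod int ?N) * g ?r j" if j: "j < ?N" for j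
        proof -
          have "(int (pos p) + (\<Sum>i<j. c i)) mod int ?N = (int (pos p) + int (min j (?N - 2))) mod int ?N"
            using cong_add[OF cong_refl K[OF j]] unfolding c_def cong_def .
          moreover have "index_at (c j + (int (pos p) + (\<Sum>i<j. c i)) mod int ?N - (int (pos q) - (\<Sum>i\<in>{Suc j..<?N}. c i)) mod int ?N) = ?r"
          proof (rule index_at_cong)
            have "T = (\<Sum>i<j. c i) + c j + (\<Sum>i\<in>{Suc j..<?N}. c i)"
              unfolding T_def using j sum.atLeastLessThan_concat[of 0 "Suc j" ?N c]
              by (simp add: atLeast0LessThan)
            then have "T + int (pos p) - int (pos q)
                = c j + (int (pos p) + (\<Sum>i<j. c i)) - (int (pos q) - (\<Sum>i\<in>{Suc j..<?N}. c i))" by simp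
            then show "[c j + (int (pos p) + (\<Sum>i<j. c i)) mod int ?N
                - (int (pos q) - (\<Sum>i\<in>{Suc j..<?N}. c i)) mod int ?N = T + int (pos p) - int (pos q)] (mod int ?N)"
              by (simp only:) (intro cong_diff cong_add cong_refl, simp_all only: cong_mod_left cong_refl)
          qed
          ultimately show ?thesis by (simp only: G'_H[OF j] pos_index_at)
        qed
        then show ?thesis unfolding D_nth by simp
      qed
      also have "\<dots> = of_nat ?N ^ (?N - 1) * m ?r (pos p)"
        using g[OF pos_less[of p]] by simp
      also have "\<dots> = M $ p $ index_at (T + int (pos p) - int (pos ?r))"
        by (simp add: m_def index_at_pos)
      also have "index_at (T + int (pos p) - int (pos ?r)) = (index_at (int (pos q)) :: 'n)"
        unfolding pos_index_at by (rule index_at_cong) (simp add: cong_def mod_simps)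
      finally show ?thesis by (simp add: index_at_pos)
    qed
    then have "D X0 H = M" by (simp add: vec_eq_iff)
    then show "D X0 (SOME H. D X0 H = M) = M" by (rule someI)
  qed
  moreover have "linear (D X0)" using der[OF X0] by (rule has_derivative_linear)
  ultimately obtain h where h: "linear h" "D X0 \<circ> h = id"
    using linear_surjective_right_inverse by blast
  have "continuous_on nonvanishing \<Phi>"
    by (rule has_derivative_continuous_on) (rule has_derivative_at_withinI[OF der])
  moreover have "X0 \<in> interior nonvanishing"
    using X0 by (simp add: interior_open[OF open_nonvanishing])
  ultimately have "\<Phi> X0 \<in> interior (\<Phi> ` nonvanishing)"
    using sussmann_open_mapping[OF open_nonvanishing _ X0 der[OF X0] _ h(2) subset_refl] h(1)
    by (simp add: linear_conv_bounded_linear)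
  then show ?thesis by blast
qed

section \<open>The generic statement\<close>

lemma foldr_interleave:
  "foldr (\<lambda>k B. M k ** B) (concat (map (\<lambda>l. [Inl (a l), Inr (b l)]) ls)) (mat 1)
     = matrix_prod (\<lambda>l. M (Inl (a l)) ** M (Inr (b l))) ls"
  by (induction ls) (simp_all add: matrix_mul_assoc)

lemma enumeration_interleave:
  fixes a b :: "nat \<Rightarrow> 'n::finite"
  assumes "bij_betw a {..<CARD('n)} UNIV" "bij_betw b {..<CARD('n)} UNIV"
  defines "ks \<equiv> concat (map (\<lambda>l. [Inl (a l), Inr (b l)]) [0..<CARD('n)])"
  shows "distinct ks" "set ks = UNIV"
proof -
  have "set ks = Inl ` a ` {..<CARD('n)} \<union> Inr ` b ` {..<CARD('n)}"
    by (auto simp: ks_def)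
  then show set: "set ks = UNIV"
    using assms(1,2) by (simp add: bij_betw_def UNIV_sum)
  have "length ks = 2 * CARD('n)"
    by (simp add: ks_def length_concat comp_def sum_list_triv)
  then show "distinct ks"
    by (intro card_distinct) (simp add: set)
qed

text \<open>An integer power as a polynomial function of \<open>x\<close> and its inverse \<open>y\<close>.\<close>

definition laurent_power :: "int \<Rightarrow> complex \<Rightarrow> complex \<Rightarrow> complex" where
  "laurent_power k x y = (if k \<ge> 0 then x ^ nat k else y ^ nat (- k))"

lemma laurent_power_eq: "x * y = 1 \<Longrightarrow> laurent_power k x y = x powi k"
  by (auto simp: laurent_power_def power_int_def inverse_unique)

lemma polyfun_laurent_power: "polyfun f \<Longrightarrow> polyfun g \<Longrightarrow> polyfun (\<lambda>e. laurent_power k (f e) (g e))"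
  by (cases "k \<ge> 0") (simp_all add: laurent_power_def polyfun_power)

lemma polyfun_matrix_mult:
  assumes "\<And>p q. polyfun (\<lambda>e. A e $ p $ q)" "\<And>p q. polyfun (\<lambda>e. B e $ p $ q)"
  shows "polyfun (\<lambda>e. (A e ** B e) $ p $ q)"
  unfolding matrix_matrix_mult_def by (simp add: polyfun_sum polyfun.mult assms)

lemma polyfun_matrix_prod:
  assumes "\<And>i p q. polyfun (\<lambda>e. G e i $ p $ q)"
  shows "polyfun (\<lambda>e. matrix_prod (G e) is $ p $ q)"
proof (induction "is" arbitrary: p q)
  case Nil
  show ?case by (simp add: polyfun.const)
next
  case (Cons i "is")
  show ?case by simp (intro polyfun_matrix_mult assms Cons.IH)
qed

theorem proposition6p5:
  fixes s :: "'n::{finite,linorder} \<Rightarrow> int"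
  assumes "\<And>i j. i \<noteq> j \<Longrightarrow> \<not> [s i = s j] (mod int CARD('n))"
    and "(\<Sum>j\<in>UNIV. s j) \<noteq> 0"
  shows "generic_matrix (\<lambda>A :: complex ^ 'n::{finite,linorder} ^ 'n::{finite,linorder}.
           product_of_elements_in
             (case_sum (\<lambda>i::'n. Vand (s i)) (\<lambda>i::'n. Vand_transpose (s i))) A)"
proof -
  let ?N = "CARD('n)"
  obtain a b where ab: "bij_betw a {..<?N} UNIV" "bij_betw b {..<?N} UNIV"
    and K: "\<And>j. j < ?N \<Longrightarrow> [(\<Sum>i<j. s (a i) - s (b i)) = int (min j (?N - 2))] (mod int ?N)"
    using exists_pairing[of s, OF assms(1)] by blast
  define \<Phi> where "\<Phi> X = matrix_prod
      (\<lambda>l. gen_vandermonde (s (a l)) (X $ a l) ** inv_fourier (s (b l))) [0..<?N]" for X :: "'n cmatrix"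
  have inj: "inj s"
    using assms(1) by (intro injI) (metis cong_refl)
  have one: "s (a 0) \<noteq> 0" if N1: "?N = 1"
  proof -
    obtain i where i: "(UNIV :: 'n set) = {i}" by (rule card_1_singletonE[OF N1])
    then have "a 0 = i" by (metis UNIV_I singletonD)
    moreover have "(\<Sum>j\<in>UNIV. s j) = s i" unfolding i by simp
    ultimately show ?thesis using assms(2) by simp
  qed
  have interior: "interior (\<Phi> ` nonvanishing) \<noteq> {}"
    unfolding \<Phi>_def by (rule interior_vandermonde_products[OF ab(1) K one inj])
  define nodes where "nodes e i k = (e (Inr (False, i, k)) :: complex)"
    for e :: "'n \<times> 'n + bool \<times> 'n \<times> 'n \<Rightarrow> complex" and i k
  define inverses where "inverses e i k = (e (Inr (True, i, k)) :: complex)"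
    for e :: "'n \<times> 'n + bool \<times> 'n \<times> 'n \<Rightarrow> complex" and i k
  define factor :: "_ \<Rightarrow> _ \<Rightarrow> 'n cmatrix" where "factor e l =
      (\<chi> p q. laurent_power (s (a l) + int (pos p)) (nodes e (a l) q) (inverses e (a l) q)) ** inv_fourier (s (b l))"
    for e l
  \<comment> \<open>The unknowns are the nodes and their inverses, which makes all entries polynomial.\<close>
  define C where "C e \<longleftrightarrow> (\<forall>ik\<in>UNIV. nodes e (fst ik) (snd ik) * inverses e (fst ik) (snd ik) - 1 = 0) \<and>
      (\<forall>pq\<in>UNIV. e (Inl pq) - matrix_prod (factor e) [0..<?N] $ fst pq $ snd pq = 0)" for e
  have nodes: "polyfun (\<lambda>e. nodes e i k)" "polyfun (\<lambda>e. inverses e i k)" for i k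
    unfolding nodes_def inverses_def by (rule polyfun.var)+
  have "polyfun (\<lambda>e. factor e l $ p $ q)" for l p q
    unfolding factor_def
    by (intro polyfun_matrix_mult) (simp_all add: polyfun.const polyfun_laurent_power nodes)
  then have "constructible C"
    unfolding C_def[abs_def]
    by (intro constructible.conj constructible_Ball constructible.zero polyfun_diff polyfun.mult
        polyfun.const polyfun.var polyfun_matrix_prod nodes) auto
  moreover have C_iff: "C (case_sum (entries A) y) \<longleftrightarrow>
      (\<forall>i k. y (False, i, k) * y (True, i, k) = 1) \<and> A = \<Phi> (\<chi> i k. y (False, i, k))" for A y
  proof -
    let ?e = "case_sum (entries A) y"
    have "factor ?e = (\<lambda>l. gen_vandermonde (s (a l)) (\<chi> k. y (False, a l, k)) ** inv_fourier (s (b l)))"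
      if "\<And>i k. y (False, i, k) * y (True, i, k) = 1"
      by (intro ext) (simp add: factor_def nodes_def inverses_def laurent_power_eq[OF that]
          gen_vandermonde_def index_pos_eq)
    then have factor: "matrix_prod (factor ?e) [0..<?N] = \<Phi> (\<chi> i k. y (False, i, k))"
      if "\<forall>i k. y (False, i, k) * y (True, i, k) = 1"
      using that by (simp add: \<Phi>_def)
    have "C ?e \<longleftrightarrow> (\<forall>i k. y (False, i, k) * y (True, i, k) = 1) \<and> A = matrix_prod (factor ?e) [0..<?N]"
      by (auto simp: C_def nodes_def inverses_def vec_eq_iff)
    also have "\<dots> \<longleftrightarrow> (\<forall>i k. y (False, i, k) * y (True, i, k) = 1) \<and> A = \<Phi> (\<chi> i k. y (False, i, k))"
      by (rule conj_cong[OF refl]) (drule factor, erule ssubst, rule refl)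
    finally show ?thesis .
  qed
  moreover have "\<exists>y. C (case_sum (entries A) y)" if A: "A \<in> interior (\<Phi> ` nonvanishing)" for A
  proof -
    have "A \<in> \<Phi> ` nonvanishing" using A interior_subset by blast
    then obtain X where X: "A = \<Phi> X" "X \<in> nonvanishing" by blast
    define y where "y = (\<lambda>(t, i, k). if t then inverse (X $ i $ k) else X $ i $ k)"
    have "(\<chi> i k. y (False, i, k)) = X" by (simp add: vec_eq_iff y_def)
    then have "C (case_sum (entries A) y)"
      using X by (simp add: C_iff y_def nonvanishing_def)
    then show ?thesis by blast
  qed
  moreover have "product_of_elements_in (case_sum (\<lambda>i. Vand (s i)) (\<lambda>i. Vand_transpose (s i))) A"
    if C: "C (case_sum (entries A) y)" for A y
  proof -
    let ?x = "\<lambda>i. \<chi> k. y (False, i, k)"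
    define M where "M = case_sum (\<lambda>i. gen_vandermonde (s i) (?x i)) (\<lambda>i. inv_fourier (s i))"
    have "y (False, i, k) \<noteq> 0" for i k using C unfolding C_iff by (metis mult_zero_left zero_neq_one)
    then have "gen_vandermonde (s i) (?x i) \<in> Vand (s i)" for i
      unfolding Vand_def by auto
    then have "M k \<in> case_sum (\<lambda>i. Vand (s i)) (\<lambda>i. Vand_transpose (s i)) k" for k
      by (auto simp: M_def inv_fourier_in_Vand_transpose split: sum.split)
    moreover have "A = foldr (\<lambda>k B. M k ** B) (concat (map (\<lambda>l. [Inl (a l), Inr (b l)]) [0..<?N])) (mat 1)"
      using C unfolding C_iff foldr_interleave by (simp add: \<Phi>_def M_def)
    ultimately show ?thesis
      unfolding product_of_elements_in_def using enumeration_interleave[OF ab] by blast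
  qed
  ultimately show ?thesis
    using generic_matrix_projection[of C "interior (\<Phi> ` nonvanishing)"] interior by blast
qed

end
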